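(* Let $P,R:\mathbb{R}\to\mathbb{R}$ be $C^2$, $2\pi$-periodic functions, let $\kappa_*:=\sup\{\kappa>0 : 1-\kappa P(x)R(x)>0\ \ \forall x\in\mathbb{R}\}\in(0,+\infty]$, and assume that $$\int_0^{2\pi}\frac{P(s)R'(s)}{1-\kappa P(s)R(s)}\,ds>0\qquad\text{for all }\kappa\in(0,\kappa_* ).$$ Then there exists an open set $U\subset(0,1)\times(0,\kappa_* )$ of parameters $(\gamma,\kappa)$, independent of $N$ and of the natural frequencies, whose closure contains $\{0\}\times[0,\kappa_*]$ (read as $\{0\}\times[0,+\infty)$ if $\kappa_*=+\infty$), such that for every $(\gamma,\kappa)\in U$ there is a $2\pi$-periodic $C^2$ function $\Delta_{\gamma,\kappa}:\mathbb{R}\to(0,1)$, independent of $N$ and of the natural frequencies, with the following properties. For every $N\ge 1$ and every choice of natural frequencies $\omega_1,\dots,\omega_N\in(1-\gamma,1+\gamma)$, consider the Winfree system $$\dot x_i=\omega_i-\kappa\,\frac1N\sum_{j=1}^N P(x_j)R(x_i),\qquad i=1,\dots,N.$$ 1. The open set $$C^N_{\gamma,\kappa}:=\Big\{X=(x_i)_{i=1}^N\in\mathbb{R}^N:\ \max_{i,j}|x_j-x_i|<\Delta_{\gamma,\kappa}\Big(\frac1N\sum_{i=1}^N x_i\Big)\Big\}$$ is invariant under the flow in forward time: if $X(0)\in C^N_{\gamma,\kappa}$ then the solution satisfies $X(t)\in C^N_{\gamma,\kappa}$ for all $t\ge 0$. In particular, for initial conditions in $C^N_{\gamma,\kappa}$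 the oscillators are synchronized. 2. There exist an initial condition $(x_i^*(0))_{i=1}^N\in C^N_{\gamma,\kappa}$ and a common frequency $\Omega_{\gamma,\kappa}>0$ such that the corresponding solution has the form $$x_i^*(t)=\Omega_{\gamma,\kappa}t+\Psi^N_{i,\gamma,\kappa}(t),\qquad\forall i=1,\dots,N,\ \forall t\ge 0,$$ where the functions $\Psi^N_{i,\gamma,\kappa}:\mathbb{R}^+\to\mathbb{R}$ are $C^2$, $2\pi/\Omega_{\gamma,\kappa}$-periodic, and bounded uniformly with respect to $N$. In particular, the oscillators are periodically locked for this initial condition.
   Context: The phases $x_i(t)$ are real-valued (lifts of points of the circle). Oscillators $x_1(t),\dots,x_N(t)$ are called synchronized if $\sup_{1\le i,j\le N}|x_i(t)-x_j(t)|$ is bounded from above uniformly in $t\ge 0$. They are called periodically locked to the frequency $\Omega$ if they are synchronized and there exist $2\pi/\Omega$-periodic functions $\Psi_i$ such that $x_i(t)=\Omega t+\Psi_i(t)$ for all $i=1,\dots,N$ and all $t\ge 0$. Here $\mathbb{R}^+=[0,+\infty)$. The common frequency and the functions $\Psi^N_{i,\gamma,\kappa}$ may depend on $N$ and on the chosen natural frequencies. *)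

theory Defs
  imports "HOL-Analysis.Analysis" "HOL-Library.Periodic_Fun"
begin

text \<open>Derivatives are taken within \<open>S\<close>, hence one-sided at an endpoint of an interval.\<close>

definition C2_on :: "real set \<Rightarrow> (real \<Rightarrow> real) \<Rightarrow> bool" where
  "C2_on S f \<longleftrightarrow> (\<exists>f' f''.
     (\<forall>x\<in>S. (f has_real_derivative f' x) (at x within S)) \<and>
     (\<forall>x\<in>S. (f' has_real_derivative f'' x) (at x within S)) \<and>
     continuous_on S f'')"

definition kappa_star :: "(real \<Rightarrow> real) \<Rightarrow> (real \<Rightarrow> real) \<Rightarrow> ereal" where
  "kappa_star P R = Sup (ereal ` {\<kappa>. \<kappa> > 0 \<and> (\<forall>x. 1 - \<kappa> * P x * R x > 0)})"

text \<open>
  Points of \<open>\<real>\<^sup>N\<close> are elements of \<^term>\<open>topspace (Euclidean_space N)\<close>, i.e. sequences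
  \<open>X :: nat \<Rightarrow> real\<close> with \<open>X i = 0\<close> for \<open>i \<ge> N\<close>; the oscillators are indexed by \<open>0, \<dots>, N - 1\<close>.
\<close>

definition spread :: "nat \<Rightarrow> (nat \<Rightarrow> real) \<Rightarrow> real" where
  "spread N X = (MAX (i, j) \<in> {..<N} \<times> {..<N}. \<bar>X j - X i\<bar>)"

definition mean :: "nat \<Rightarrow> (nat \<Rightarrow> real) \<Rightarrow> real" where
  "mean N X = (1 / real N) * (\<Sum>i<N. X i)"

definition sync_tube :: "nat \<Rightarrow> (real \<Rightarrow> real) \<Rightarrow> (nat \<Rightarrow> real) set" where
  "sync_tube N \<Delta> = {X \<in> topspace (Euclidean_space N). spread N X < \<Delta> (mean N X)}"

definition winfree_solution ::
  "nat \<Rightarrow> (real \<Rightarrow> real) \<Rightarrow> (real \<Rightarrow> real) \<Rightarrow> real \<Rightarrow> (nat \<Rightarrow> real) \<Rightarrow> (real \<Rightarrow> nat \<Rightarrow> real) \<Rightarrow> bool"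
where
  "winfree_solution N P R \<kappa> \<omega> x \<longleftrightarrow>
     (\<forall>t\<ge>0. x t \<in> topspace (Euclidean_space N)) \<and>
     (\<forall>t\<ge>0. \<forall>i<N. ((\<lambda>s. x s i) has_real_derivative
        \<omega> i - \<kappa> * ((1 / real N) * (\<Sum>j<N. P (x t j) * R (x t i)))) (at t within {0..}))"

definition synchronized :: "nat \<Rightarrow> (real \<Rightarrow> nat \<Rightarrow> real) \<Rightarrow> bool" where
  "synchronized N x \<longleftrightarrow> bdd_above ((\<lambda>t. spread N (x t)) ` {0..})"

definition periodically_locked :: "nat \<Rightarrow> real \<Rightarrow> (real \<Rightarrow> nat \<Rightarrow> real) \<Rightarrow> bool" where
  "periodically_locked N \<Omega> x \<longleftrightarrow> \<Omega> \<noteq> 0 \<and> synchronized N x \<and>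
     (\<exists>\<Psi>. (\<forall>i<N. periodic_fun_simple (\<Psi> i) (2 * pi / \<Omega>)) \<and>
           (\<forall>i<N. \<forall>t\<ge>0. x t i = \<Omega> * t + \<Psi> i t))"

end

theory Submission
  imports Defs
begin

text \<open>
  On the synchronised orbit the phase \<open>\<mu>\<close> moves with speed \<open>1 - \<kappa> P R > 0\<close> and, to first order, a
  difference \<open>x\<^sub>j - x\<^sub>i\<close> grows with rate \<open>- \<kappa> P R' / (1 - \<kappa> P R)\<close> per unit of phase. The mean of this
  rate over a period is some \<open>- c < 0\<close>, so there is a positive periodic \<open>h\<close> whose logarithmic
  derivative is the rate plus \<open>c\<close>. For small \<open>\<epsilon>\<close> the tube of width \<open>\<Delta> = \<epsilon> h(\<mu>)\<close> is therefore crossed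
  inwards, with a margin of order \<open>c \<epsilon>\<close> that absorbs the quadratic errors, the spread \<open>\<gamma>\<close> of the
  natural frequencies and a small change of \<open>\<kappa>\<close>; hence a whole box of parameters
  \<open>(0, r) \<times> (\<kappa> - r, \<kappa> + r)\<close> is admissible, and \<open>U\<close> is the union of these boxes.

  The locked orbit is found without a fixed-point theorem for the Poincare map. Write
  \<open>x\<^sub>i = \<theta> + z\<^sub>i(\<theta>)\<close> with \<open>\<theta>' = 1 - \<kappa> p R(\<theta>)\<close>, where \<open>p\<close> is the mean of the \<open>P(x\<^sub>j)\<close>. In the variables
  \<open>u\<^sub>i = z\<^sub>i / h\<close> the system reads \<open>u\<^sub>i' = - c u\<^sub>i + q\<^sub>i(\<theta>, u)\<close> with \<open>q\<close> periodic in \<open>\<theta>\<close> and of small Lipschitz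
  constant in the sup norm, uniformly in \<open>N\<close>. So the map sending \<open>u\<close> to the periodic solution \<open>v\<close> of
  \<open>v' = - c v + q(\<theta>, u)\<close> is a contraction, and inverting \<open>t = \<integral> d\<theta> / \<theta>'\<close> returns to the time variable.
\<close>

section \<open>Contractions and scalar linear equations\<close>

text \<open>The ball of radius \<open>\<rho>\<close> for the supremum over time and index together.
  With \<open>p = 0\<close> the periodicity clause is void, so the same space serves the initial
  value problem and, with \<open>p = 2 * pi\<close>, the periodic one.\<close>

definition bounded_periodic :: "real \<Rightarrow> real \<Rightarrow> (real \<Rightarrow> 'i \<Rightarrow> real) \<Rightarrow> bool" where
  "bounded_periodic \<rho> p z \<longleftrightarrow> (\<forall>i. continuous_on UNIV (\<lambda>t. z t i)) \<and>
     (\<forall>t i. \<bar>z t i\<bar> \<le> \<rho>) \<and> (\<forall>t i. z (t + p) i = z t i)"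

text \<open>Picard iteration from 0: successive iterates differ by at most
  \<open>\<rho> * (1/2)^n\<close>, so they converge uniformly, and the conditions of
  \<open>bounded_periodic\<close> pass to the limit. The contraction is expressed through an
  arbitrary pointwise bound \<open>d\<close>, so that no supremum has to be formed.\<close>

lemma fixpoint_of_sup_contraction:
  fixes A :: "(real \<Rightarrow> 'i \<Rightarrow> real) \<Rightarrow> real \<Rightarrow> 'i \<Rightarrow> real" and \<rho> p :: real
  assumes "0 \<le> \<rho>"
    and A_adm: "\<And>z. bounded_periodic \<rho> p z \<Longrightarrow> bounded_periodic \<rho> p (A z)"
    and A_contr: "\<And>z y d t i. bounded_periodic \<rho> p z \<Longrightarrow> bounded_periodic \<rho> p y \<Longrightarrow>
      (\<And>t i. \<bar>z t i - y t i\<bar> \<le> d) \<Longrightarrow> \<bar>A z t i - A y t i\<bar> \<le> d / 2"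
  shows "\<exists>z. bounded_periodic \<rho> p z \<and> A z = z"
proof -
  define z where "z n = (A ^^ n) (\<lambda>_ _. 0)" for n
  have z_Suc: "z (Suc n) = A (z n)" for n by (simp add: z_def)
  have z_adm: "bounded_periodic \<rho> p (z n)" for n
  proof (induction n)
    case 0 show ?case using \<open>0 \<le> \<rho>\<close> by (simp add: z_def bounded_periodic_def)
  next
    case (Suc n) then show ?case by (simp add: z_Suc A_adm)
  qed
  have step: "\<bar>z (Suc n) t i - z n t i\<bar> \<le> \<rho> * (1/2)^n" for n t i
  proof (induction n arbitrary: t i)
    case 0 show ?case using z_adm[of 1] by (simp add: z_def bounded_periodic_def)
  next
    case (Suc n)
    have "\<bar>A (z (Suc n)) t i - A (z n) t i\<bar> \<le> (\<rho> * (1/2)^n) / 2"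
      using A_contr[OF z_adm z_adm] Suc.IH by blast
    then show ?case by (simp add: z_Suc)
  qed
  \<comment> \<open>Time and index are packed into one pair, which makes the convergence uniform in
    both, even for an infinite index type.\<close>
  have "uniform_limit UNIV (\<lambda>n x. \<Sum>k<n. z (Suc k) (fst x) (snd x) - z k (fst x) (snd x))
      (\<lambda>x. \<Sum>k. z (Suc k) (fst x) (snd x) - z k (fst x) (snd x)) sequentially"
    by (rule Weierstrass_m_test[where M = "\<lambda>n. \<rho> * (1/2)^n"])
      (use step in \<open>auto intro!: summable_mult summable_geometric\<close>)
  moreover have "(\<Sum>k<n. z (Suc k) t i - z k t i) = z n t i" for n t i
    by (subst sum_lessThan_telescope) (simp add: z_def)
  ultimately obtain y where lim: "uniform_limit UNIV (\<lambda>n x. z n (fst x) (snd x)) y sequentially"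
    by simp
  define w where "w t i = y (t, i)" for t i
  have close: "\<forall>\<^sub>F n in sequentially. \<forall>t i. \<bar>z n t i - w t i\<bar> < e" if "e > 0" for e
    using uniform_limitD[OF lim that] by (auto simp: w_def dist_real_def elim!: eventually_mono)
  have unif: "uniform_limit UNIV (\<lambda>n t. z n t i) (\<lambda>t. w t i) sequentially" for i
    unfolding uniform_limit_iff dist_real_def
  proof (intro allI impI)
    fix e :: real assume "e > 0"
    from close[OF this] show "\<forall>\<^sub>F n in sequentially. \<forall>t\<in>UNIV. \<bar>z n t i - w t i\<bar> < e"
      by (rule eventually_mono) blast
  qed
  have ptw: "(\<lambda>n. z n t i) \<longlonglongrightarrow> w t i" for t i
    using tendsto_uniform_limitI[OF unif] by auto
  have w_adm: "bounded_periodic \<rho> p w"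
    unfolding bounded_periodic_def
  proof (intro conjI allI)
    show "continuous_on UNIV (\<lambda>t. w t i)" for i
      by (rule uniform_limit_theorem[OF _ unif]) (use z_adm in \<open>auto simp: bounded_periodic_def\<close>)
    show "\<bar>w t i\<bar> \<le> \<rho>" for t i
      by (rule LIMSEQ_le_const2[OF tendsto_rabs[OF ptw]]) (use z_adm in \<open>auto simp: bounded_periodic_def\<close>)
    show "w (t + p) i = w t i" for t i
      by (rule LIMSEQ_unique[OF ptw]) (use z_adm ptw in \<open>simp add: bounded_periodic_def\<close>)
  qed
  have "A w t i = w t i" for t i
  proof (rule LIMSEQ_unique)
    show "(\<lambda>n. z (Suc n) t i) \<longlonglongrightarrow> w t i" by (rule LIMSEQ_Suc[OF ptw])
    show "(\<lambda>n. z (Suc n) t i) \<longlonglongrightarrow> A w t i"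
      unfolding z_Suc
    proof (rule tendstoI)
      fix e :: real assume "e > 0"
      from close[OF this] show "\<forall>\<^sub>F n in sequentially. dist (A (z n) t i) (A w t i) < e"
      proof eventually_elim
        case (elim n)
        have "\<bar>A (z n) t i - A w t i\<bar> \<le> e / 2"
          by (rule A_contr[OF z_adm w_adm]) (use elim less_imp_le in blast)
        then show ?case using \<open>e > 0\<close> by (simp add: dist_real_def)
      qed
    qed
  qed
  with w_adm show ?thesis by blast
qed

section \<open>The scalar equation w' = g - c w\<close>

lemma real_antiderivative_exists:
  fixes f :: "real \<Rightarrow> real"
  assumes "continuous_on UNIV f"
  obtains F where "\<And>x. (F has_real_derivative f x) (at x)"
proof -
  have "\<exists>F. \<forall>x :: real. -\<infinity> < ereal x \<longrightarrow> ereal x < \<infinity> \<longrightarrow> (F has_vector_derivative f x) (at x)"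
    by (rule einterval_antiderivative)
      (use assms in \<open>auto simp: continuous_on_eq_continuous_at\<close>)
  then show ?thesis using that by (auto simp: has_real_derivative_iff_has_vector_derivative)
qed

text \<open>Both terms of \<open>F (x + p) - F x\<close> have the same derivative. Hence an
  antiderivative of a periodic function is periodic as soon as it gains nothing over one
  period.\<close>

lemma periodic_differentiable_const_increment:
  fixes F f :: "real \<Rightarrow> real"
  assumes "\<And>x. (F has_real_derivative f x) (at x)" and "\<And>x. f (x + p) = f x"
  shows "F (x + p) - F x = F p - F 0"
proof -
  have "((\<lambda>x. F (x + p) - F x) has_real_derivative 0) (at x)" for x
    using DERIV_diff[OF DERIV_shift[THEN iffD1, OF assms(1)[of "x + p"]] assms(1)[of x]]
    by (simp add: assms(2))
  then have "\<forall>x. ((\<lambda>x. F (x + p) - F x) has_real_derivative 0) (at x)" by blast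
  from DERIV_isconst_all[OF this, of x 0] show ?thesis by simp
qed

text \<open>\<open>d / c\<close> is the equilibrium of w' = d - c w, and \<open>exp (c * t)\<close>
  is the integrating factor for the distance to it. The bound on \<open>g\<close> is asked only to
  the right of \<open>a\<close>, which suits forward problems as well as periodic ones.\<close>

lemma linear_ode_le:
  fixes w g :: "real \<Rightarrow> real"
  assumes "c > 0" and "a \<le> b"
    and "\<And>t. (w has_real_derivative g t - c * w t) (at t)"
    and "\<And>t. a \<le> t \<Longrightarrow> g t \<le> d"
  shows "exp (c * b) * (w b - d / c) \<le> exp (c * a) * (w a - d / c)"
proof (rule DERIV_nonpos_imp_nonincreasing[OF \<open>a \<le> b\<close>], intro exI conjI)
  fix t assume "a \<le> t"
  show "((\<lambda>t. exp (c * t) * (w t - d / c)) has_real_derivative exp (c * t) * (g t - d)) (at t)"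
    using \<open>c > 0\<close> by (auto intro!: derivative_eq_intros assms(3) simp: field_simps)
  show "exp (c * t) * (g t - d) \<le> 0"
    using assms(4)[OF \<open>a \<le> t\<close>] by (simp add: mult_nonneg_nonpos)
qed

text \<open>If \<open>w\<close> exceeded \<open>d / c\<close> somewhere, then comparing that point
  with the one a period later in \<open>linear_ode_le\<close> would make \<open>exp (c * t)\<close>
  non-increasing over the period. The lower bound follows by applying this to
  \<open>- w\<close>.\<close>

lemma periodic_linear_ode_bound:
  fixes w g :: "real \<Rightarrow> real"
  assumes "c > 0" and "p > 0"
    and der: "\<And>t. (w has_real_derivative g t - c * w t) (at t)"
    and per: "\<And>t. w (t + p) = w t" and bnd: "\<And>t. \<bar>g t\<bar> \<le> d"
  shows "\<bar>w t\<bar> \<le> d / c"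
proof -
  have *: "w t \<le> d / c"
    if "\<And>t. (w has_real_derivative g t - c * w t) (at t)" "\<And>t. w (t + p) = w t" "\<And>t. g t \<le> d"
    for w g
  proof (rule ccontr)
    assume "\<not> w t \<le> d / c"
    moreover have "exp (c * (t + p)) * (w (t + p) - d / c) \<le> exp (c * t) * (w t - d / c)"
      by (rule linear_ode_le[OF \<open>c > 0\<close>]) (use that \<open>p > 0\<close> in auto)
    ultimately have "exp (c * (t + p)) \<le> exp (c * t)" by (simp add: that)
    then show False using \<open>c > 0\<close> \<open>p > 0\<close> by (simp add: algebra_simps mult_le_0_iff)
  qed
  have "w t \<le> d / c" using bnd by (intro *[OF der per]) (auto simp: abs_le_iff)
  moreover have "- w t \<le> d / c"
  proof (rule *)
    show "((\<lambda>t. - w t) has_real_derivative - g t - c * - w t) (at t)" for t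
      using DERIV_minus[OF der] by simp
  qed (use bnd per in \<open>auto simp: abs_le_iff\<close>)
  ultimately show ?thesis by (simp add: abs_le_iff)
qed

text \<open>The value 0 lies below the equilibrium \<open>d / c\<close>, and
  \<open>linear_ode_le\<close> keeps the solution below it; the same holds for
  \<open>- w\<close>.\<close>

lemma initial_linear_ode_bound:
  fixes w g :: "real \<Rightarrow> real"
  assumes "c > 0"
    and der: "\<And>t. (w has_real_derivative g t - c * w t) (at t)"
    and "w 0 = 0" and bnd: "\<And>t. 0 \<le> t \<Longrightarrow> \<bar>g t\<bar> \<le> d" and "0 \<le> t"
  shows "\<bar>w t\<bar> \<le> d / c"
proof -
  have "0 \<le> d" using bnd[of 0] by linarith
  have *: "w t \<le> d / c"
    if "\<And>t. (w has_real_derivative g t - c * w t) (at t)" "w 0 = 0" "\<And>t. 0 \<le> t \<Longrightarrow> g t \<le> d"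
    for w g
  proof -
    have "exp (c * t) * (w t - d / c) \<le> exp (c * 0) * (w 0 - d / c)"
      by (rule linear_ode_le[OF \<open>c > 0\<close>]) (use that \<open>0 \<le> t\<close> in auto)
    also have "\<dots> \<le> 0" using that \<open>0 \<le> d\<close> \<open>c > 0\<close> by simp
    finally show ?thesis by (simp add: mult_le_0_iff)
  qed
  have "w t \<le> d / c" using bnd \<open>w 0 = 0\<close> by (intro *[OF der]) (auto simp: abs_le_iff)
  moreover have "- w t \<le> d / c"
  proof (rule *)
    show "((\<lambda>t. - w t) has_real_derivative - g t - c * - w t) (at t)" for t
      using DERIV_minus[OF der] by simp
  qed (use bnd \<open>w 0 = 0\<close> in \<open>auto simp: abs_le_iff\<close>)
  ultimately show ?thesis by (simp add: abs_le_iff)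
qed

lemma linear_ode_solution:
  fixes g :: "real \<Rightarrow> real"
  assumes "continuous_on UNIV g"
  obtains w where "\<And>t. (w has_real_derivative g t - c * w t) (at t)" and "w 0 = y"
proof -
  obtain Q where Q: "\<And>t. (Q has_real_derivative exp (c * t) * g t) (at t)"
    by (rule real_antiderivative_exists[of "\<lambda>t. exp (c * t) * g t"])
      (auto intro!: continuous_intros assms)
  show ?thesis
  proof
    show "((\<lambda>t. exp (- (c * t)) * (Q t - Q 0 + y)) has_real_derivative
        g t - c * (exp (- (c * t)) * (Q t - Q 0 + y))) (at t)" for t
      by (auto intro!: derivative_eq_intros Q simp: algebra_simps exp_minus)
  qed simp
qed

text \<open>Any solution becomes periodic after adding a suitable multiple of the homogeneous
  solution \<open>exp (- (c * t))\<close>; since c and p are positive, this solution changes over a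
  period.\<close>

lemma periodic_linear_ode_solution:
  fixes g :: "real \<Rightarrow> real"
  assumes "continuous_on UNIV g" and "\<And>t. g (t + p) = g t" and "c > 0" and "p > 0"
  obtains w where "\<And>t. (w has_real_derivative g t - c * w t) (at t)" and "\<And>t. w (t + p) = w t"
proof -
  obtain v where v: "\<And>t. (v has_real_derivative g t - c * v t) (at t)"
    using linear_ode_solution[OF assms(1)] by metis
  have "exp (- (c * p)) < 1" using assms by simp
  \<comment> \<open>The only value of \<open>k\<close> for which \<open>w p = w 0\<close>.\<close>
  define k where "k = (v p - v 0) / (1 - exp (- (c * p)))"
  define w where "w t = v t + k * exp (- (c * t))" for t
  have w: "(w has_real_derivative g t - c * w t) (at t)" for t
    unfolding w_def by (auto intro!: derivative_eq_intros v simp: algebra_simps)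
  have "k * (1 - exp (- (c * p))) = v p - v 0"
    using \<open>exp (- (c * p)) < 1\<close> unfolding k_def by (metis diff_gt_0_iff_gt less_irrefl nonzero_eq_divide_eq)
  then have w0: "w p = w 0" by (simp add: w_def algebra_simps)
  \<comment> \<open>The difference \<open>w (t + p) - w t\<close> solves the homogeneous equation,
    so its product with \<open>exp (c * t)\<close> is constant, and it vanishes at 0.\<close>
  have "w (t + p) = w t" for t
  proof -
    have "((\<lambda>t. exp (c * t) * (w (t + p) - w t)) has_real_derivative
        c * exp (c * t) * (w (t + p) - w t) +
        exp (c * t) * ((g (t + p) - c * w (t + p)) - (g t - c * w t))) (at t)" for t
      by (auto intro!: derivative_eq_intros w DERIV_shift[THEN iffD1, OF w])
    moreover have "c * exp (c * t) * (w (t + p) - w t) +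
        exp (c * t) * ((g (t + p) - c * w (t + p)) - (g t - c * w t)) = 0" for t
      unfolding assms(2) by (simp add: algebra_simps)
    ultimately have "((\<lambda>t. exp (c * t) * (w (t + p) - w t)) has_real_derivative 0) (at t)" for t
      by metis
    then have "\<forall>t. ((\<lambda>t. exp (c * t) * (w (t + p) - w t)) has_real_derivative 0) (at t)" by blast
    from DERIV_isconst_all[OF this, of t 0] show ?thesis using w0 by simp
  qed
  with w that show ?thesis by blast
qed

section \<open>The Winfree vector field\<close>

lemma mean_mult_right: "mean N (\<lambda>j. f j * c) = mean N f * c"
  by (simp add: mean_def sum_distrib_right)

lemma mean_cong: "(\<And>j. j < N \<Longrightarrow> f j = g j) \<Longrightarrow> mean N f = mean N g"
  by (simp add: mean_def)

lemma abs_mean_diff_le: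
  assumes "\<And>j. j < N \<Longrightarrow> \<bar>f j - g j\<bar> \<le> d" and "0 \<le> d"
  shows "\<bar>mean N f - mean N g\<bar> \<le> d"
proof (cases "N = 0")
  case False
  have "\<bar>\<Sum>j<N. f j - g j\<bar> \<le> (\<Sum>j<N. d)"
    by (rule order_trans[OF sum_abs sum_mono]) (use assms in auto)
  moreover have "mean N f - mean N g = (\<Sum>j<N. f j - g j) / N"
    by (simp add: mean_def sum_subtractf diff_divide_distrib)
  ultimately show ?thesis using False by (simp add: abs_divide divide_le_eq mult.commute)
qed (simp add: mean_def \<open>0 \<le> d\<close>)

lemma abs_mean_le:
  assumes "\<And>j. j < N \<Longrightarrow> \<bar>f j\<bar> \<le> d" and "0 \<le> d"
  shows "\<bar>mean N f\<bar> \<le> d"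
  using abs_mean_diff_le[of N f "\<lambda>_. 0" d] assms by (simp add: mean_def)

lemma abs_mean_diff_const_le:
  assumes "N \<ge> 1" "\<And>j. j < N \<Longrightarrow> \<bar>f j - c\<bar> \<le> d"
  shows "\<bar>mean N f - c\<bar> \<le> d"
proof -
  have "0 \<le> d" using assms(2)[of 0] \<open>N \<ge> 1\<close> by auto
  moreover have "mean N (\<lambda>_. c) = c" using \<open>N \<ge> 1\<close> by (simp add: mean_def)
  ultimately show ?thesis using abs_mean_diff_le[of N f "\<lambda>_. c" d] assms by simp
qed

lemma has_real_derivative_mean:
  assumes "\<And>j. j < N \<Longrightarrow> ((\<lambda>t. f t j) has_real_derivative f' j) (at x within S)"
  shows "((\<lambda>t. mean N (f t)) has_real_derivative mean N f') (at x within S)"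
proof -
  have "((\<lambda>t. \<Sum>j<N. f t j) has_real_derivative (\<Sum>j<N. f' j)) (at x within S)"
    by (rule DERIV_sum) (use assms in auto)
  then show ?thesis unfolding mean_def by (rule DERIV_cmult)
qed

lemma continuous_on_mean [continuous_intros]:
  assumes "\<And>j. j < N \<Longrightarrow> continuous_on S (\<lambda>t. f t j)"
  shows "continuous_on S (\<lambda>t. mean N (f t))"
  unfolding mean_def by (intro continuous_intros) (use assms in auto)

lemma abs_mult_diff_le:
  fixes x y x' y' :: real
  assumes "\<bar>x - x'\<bar> \<le> a" "\<bar>y\<bar> \<le> B" "\<bar>x'\<bar> \<le> C" "\<bar>y - y'\<bar> \<le> b"
  shows "\<bar>x * y - x' * y'\<bar> \<le> a * B + C * b"
proof -
  have "x * y - x' * y' = (x - x') * y + x' * (y - y')" by (simp add: algebra_simps)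
  also have "\<bar>\<dots>\<bar> \<le> \<bar>x - x'\<bar> * \<bar>y\<bar> + \<bar>x'\<bar> * \<bar>y - y'\<bar>"
    by (metis abs_mult abs_triangle_ineq)
  also have "\<dots> \<le> a * B + C * b"
    using assms by (intro add_mono mult_mono) (auto intro: order_trans[OF abs_ge_zero])
  finally show ?thesis .
qed

section \<open>The flow of the Winfree system\<close>

definition winfree_field ::
  "nat \<Rightarrow> (real \<Rightarrow> real) \<Rightarrow> (real \<Rightarrow> real) \<Rightarrow> real \<Rightarrow> (nat \<Rightarrow> real) \<Rightarrow> (nat \<Rightarrow> real) \<Rightarrow> nat \<Rightarrow> real"
where
  "winfree_field N P R \<kappa> \<omega> X i = \<omega> i - \<kappa> * (mean N (\<lambda>j. P (X j)) * R (X i))"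

lemma winfree_solution_iff:
  "winfree_solution N P R \<kappa> \<omega> x \<longleftrightarrow>
     (\<forall>t\<ge>0. \<forall>i\<ge>N. x t i = 0) \<and>
     (\<forall>t\<ge>0. \<forall>i<N. ((\<lambda>s. x s i) has_real_derivative winfree_field N P R \<kappa> \<omega> (x t) i)
        (at t within {0..}))"
  by (simp add: winfree_solution_def topspace_Euclidean_space winfree_field_def
      mean_mult_right[symmetric]) (simp add: mean_def)

lemma winfree_field_cong:
  "i < N \<Longrightarrow> (\<And>j. j < N \<Longrightarrow> X j = Y j) \<Longrightarrow>
    winfree_field N P R \<kappa> \<omega> X i = winfree_field N P R \<kappa> \<omega> Y i"
  by (simp add: winfree_field_def mean_def)

text \<open>Taking means does not increase the sup distance, so the product estimate gives a
  Lipschitz constant in the sup norm that is independent of \<open>N\<close>.\<close>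

lemma winfree_field_lipschitz:
  assumes bnd: "\<And>x. \<bar>P x\<bar> \<le> M" "\<And>x. \<bar>R x\<bar> \<le> M"
    and lip: "\<And>x y. \<bar>P x - P y\<bar> \<le> M * \<bar>x - y\<bar>" "\<And>x y. \<bar>R x - R y\<bar> \<le> M * \<bar>x - y\<bar>"
    and "0 \<le> \<kappa>" and "i < N" and d: "\<And>j. j < N \<Longrightarrow> \<bar>X j - Y j\<bar> \<le> d"
  shows "\<bar>winfree_field N P R \<kappa> \<omega> X i - winfree_field N P R \<kappa> \<omega> Y i\<bar> \<le> 2 * \<kappa> * M\<^sup>2 * d"
proof -
  have "0 \<le> M" using bnd(1)[of 0] by linarith
  have "0 \<le> d" using d[OF \<open>i < N\<close>] by linarith
  have mon: "M * \<bar>X j - Y j\<bar> \<le> M * d" if "j < N" for j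
    using d[OF that] \<open>0 \<le> M\<close> by (rule mult_left_mono)
  have "\<bar>mean N (\<lambda>j. P (X j)) * R (X i) - mean N (\<lambda>j. P (Y j)) * R (Y i)\<bar>
      \<le> (M * d) * M + M * (M * d)"
  proof (rule abs_mult_diff_le)
    show "\<bar>mean N (\<lambda>j. P (X j)) - mean N (\<lambda>j. P (Y j))\<bar> \<le> M * d"
      using \<open>0 \<le> M\<close> \<open>0 \<le> d\<close> order_trans[OF lip(1) mon] by (intro abs_mean_diff_le) auto
    show "\<bar>mean N (\<lambda>j. P (Y j))\<bar> \<le> M" by (rule abs_mean_le) (use bnd \<open>0 \<le> M\<close> in auto)
    show "\<bar>R (X i) - R (Y i)\<bar> \<le> M * d" by (rule order_trans[OF lip(2) mon[OF \<open>i < N\<close>]])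
  qed (rule bnd)
  then have "\<bar>\<kappa> * (mean N (\<lambda>j. P (Y j)) * R (Y i) - mean N (\<lambda>j. P (X j)) * R (X i))\<bar>
      \<le> \<kappa> * ((M * d) * M + M * (M * d))"
    using \<open>0 \<le> \<kappa>\<close> by (simp add: abs_mult abs_minus_commute mult_left_mono)
  also have "\<dots> = 2 * \<kappa> * M\<^sup>2 * d" by (simp add: power2_eq_square algebra_simps)
  finally show ?thesis by (simp add: winfree_field_def algebra_simps)
qed

text \<open>Picard iteration in an exponentially weighted sup norm. Writing x = X + exp(L t) y turns
  the system into y' = q - L y, and for large \<open>L\<close> the solution operator of this
  equation is a contraction on the whole half-line at once, so no continuation argument is
  required.\<close>

lemma winfree_solution_exists:
  assumes bnd: "\<And>x. \<bar>P x\<bar> \<le> M" "\<And>x. \<bar>R x\<bar> \<le> M"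
    and lip: "\<And>x y. \<bar>P x - P y\<bar> \<le> M * \<bar>x - y\<bar>" "\<And>x y. \<bar>R x - R y\<bar> \<le> M * \<bar>x - y\<bar>"
    and cont: "continuous_on UNIV P" "continuous_on UNIV R"
    and "0 \<le> \<kappa>" and X: "X \<in> topspace (Euclidean_space N)"
  shows "\<exists>x. winfree_solution N P R \<kappa> \<omega> x \<and> x 0 = X"
proof -
  have "0 \<le> M" using bnd(1)[of 0] by linarith
  define G where "G Y i = (if i < N then winfree_field N P R \<kappa> \<omega> Y i else 0)" for Y i
  define W where "W = (\<Sum>i<N. \<bar>\<omega> i\<bar>) + \<kappa> * M\<^sup>2"
  \<comment> \<open>\<open>L / 2\<close> dominates the Lipschitz constant of \<open>G\<close>,
    whence the contraction factor 1/2. The summand 1 keeps \<open>L\<close> positive when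
    \<open>\<kappa>\<close> or \<open>M\<close> is 0.\<close>
  define L where "L = 4 * \<kappa> * M\<^sup>2 + 1"
  have "L > 0" and "W \<ge> 0" using \<open>0 \<le> \<kappa>\<close>
    by (auto simp: L_def W_def intro!: add_nonneg_pos add_nonneg_nonneg sum_nonneg)
  have G_bnd: "\<bar>G Y i\<bar> \<le> W" for Y i
  proof (cases "i < N")
    case True
    have "\<bar>mean N (\<lambda>j. P (Y j)) * R (Y i)\<bar> \<le> M * M"
      unfolding abs_mult using bnd \<open>0 \<le> M\<close> by (intro mult_mono abs_mean_le) auto
    then have "\<bar>\<kappa> * (mean N (\<lambda>j. P (Y j)) * R (Y i))\<bar> \<le> \<kappa> * M\<^sup>2"
      using \<open>0 \<le> \<kappa>\<close> by (simp add: abs_mult power2_eq_square mult_left_mono)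
    moreover have "\<bar>\<omega> i\<bar> \<le> (\<Sum>i<N. \<bar>\<omega> i\<bar>)"
      using True by (intro member_le_sum) auto
    ultimately show ?thesis using True by (simp add: G_def winfree_field_def W_def)
  qed (use \<open>W \<ge> 0\<close> in \<open>simp add: G_def\<close>)
  have G_lip: "\<bar>G Y i - G Z i\<bar> \<le> L / 2 * d" if "\<And>j. \<bar>Y j - Z j\<bar> \<le> d" for Y Z i d
  proof (cases "i < N")
    case True
    have "\<bar>G Y i - G Z i\<bar> \<le> 2 * \<kappa> * M\<^sup>2 * d"
      using winfree_field_lipschitz[OF bnd lip \<open>0 \<le> \<kappa>\<close> True that] True by (simp add: G_def)
    also have "\<dots> \<le> L / 2 * d"
      using that[of 0] by (intro mult_right_mono) (auto simp: L_def)
    finally show ?thesis .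
  qed (use \<open>L > 0\<close> that[of 0] in \<open>simp add: G_def\<close>)
  have contP: "continuous_on UNIV (\<lambda>t. P (g t))" and contR: "continuous_on UNIV (\<lambda>t. R (g t))"
    if "continuous_on UNIV g" for g :: "real \<Rightarrow> real"
    using continuous_on_compose2[OF cont(1) that] continuous_on_compose2[OF cont(2) that] by auto
  define q where "q y i t = exp (- L * t) * G (\<lambda>j. X j + exp (L * t) * y t j) i" for y i t
  let ?adm = "bounded_periodic (W / L) 0 :: (real \<Rightarrow> nat \<Rightarrow> real) \<Rightarrow> bool"
  have q_cont: "continuous_on UNIV (q y i)" if "?adm y" for y i
  proof -
    have "continuous_on UNIV (\<lambda>t. y t j)" for j using that by (simp add: bounded_periodic_def)
    then have "continuous_on UNIV (\<lambda>t. X j + exp (L * t) * y t j)" for j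
      by (intro continuous_intros)
    from contP[OF this] contR[OF this] show ?thesis
      unfolding q_def G_def winfree_field_def by (cases "i < N") (auto intro!: continuous_intros)
  qed
  define V where "V y i = (SOME v. v 0 = 0 \<and>
      (\<forall>t. (v has_real_derivative q y i t - L * v t) (at t)))" for y i
  have "V y i 0 = 0 \<and> (\<forall>t. (V y i has_real_derivative q y i t - L * V y i t) (at t))"
    if "?adm y" for y i
  proof -
    from linear_ode_solution[OF q_cont[OF that], where c = L and y = 0]
    have "\<exists>v. v 0 = 0 \<and> (\<forall>t. (v has_real_derivative q y i t - L * v t) (at t))" by blast
    from someI_ex[OF this] show ?thesis unfolding V_def .
  qed
  then have V0: "V y i 0 = 0"
    and V: "(V y i has_real_derivative q y i t - L * V y i t) (at t)" if "?adm y" for y i t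
    using that by blast+
  \<comment> \<open>Solutions are frozen at negative times, because the factor
    \<open>exp (- L * t)\<close> in \<open>q\<close> is bounded by 1 only for t \<ge> 0.\<close>
  define A where "A y t i = V y i (max 0 t)" for y t i
  have "\<exists>z. ?adm z \<and> A z = z"
  proof (rule fixpoint_of_sup_contraction)
    show "0 \<le> W / L" using \<open>L > 0\<close> \<open>W \<ge> 0\<close> by simp
  next
    fix z assume z: "?adm z"
    have "continuous_on UNIV (V z i)" for i
      by (rule DERIV_continuous_on[OF has_field_derivative_at_within[OF V[OF z]]])
    then have "continuous_on UNIV (\<lambda>t. A z t i)" for i
      unfolding A_def by (rule continuous_on_compose2) (auto intro!: continuous_intros)
    moreover have "\<bar>A z t i\<bar> \<le> W / L" for t i
      unfolding A_def
    proof (rule initial_linear_ode_bound[OF \<open>L > 0\<close> V[OF z] V0[OF z]])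
      fix t :: real assume "0 \<le> t"
      have "\<bar>q z i t\<bar> \<le> 1 * W"
        unfolding q_def abs_mult using \<open>0 \<le> t\<close> \<open>L > 0\<close> by (intro mult_mono G_bnd) auto
      then show "\<bar>q z i t\<bar> \<le> W" by simp
    qed simp
    ultimately show "?adm (A z)" by (simp add: bounded_periodic_def)
  next
    fix z y d t i assume z: "?adm z" and y: "?adm y" and d: "\<And>t i. \<bar>z t i - y t i\<bar> \<le> d"
    have "\<bar>V z i (max 0 t) - V y i (max 0 t)\<bar> \<le> L / 2 * d / L"
    proof (rule initial_linear_ode_bound[OF \<open>L > 0\<close>, where w = "\<lambda>s. V z i s - V y i s"])
      show "((\<lambda>s. V z i s - V y i s) has_real_derivative
          (q z i t - q y i t) - L * (V z i t - V y i t)) (at t)" for t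
        using DERIV_diff[OF V[OF z] V[OF y]] by (simp add: algebra_simps)
      show "V z i 0 - V y i 0 = 0" by (simp add: V0 z y)
      show "\<bar>q z i t - q y i t\<bar> \<le> L / 2 * d" for t
      proof -
        have "\<bar>G (\<lambda>j. X j + exp (L * t) * z t j) i - G (\<lambda>j. X j + exp (L * t) * y t j) i\<bar>
            \<le> L / 2 * (exp (L * t) * d)"
          by (rule G_lip) (use d in \<open>simp add: abs_mult flip: right_diff_distrib\<close>)
        then have "exp (- L * t) * \<bar>G (\<lambda>j. X j + exp (L * t) * z t j) i
            - G (\<lambda>j. X j + exp (L * t) * y t j) i\<bar> \<le> exp (- L * t) * (L / 2 * (exp (L * t) * d))"
          by (rule mult_left_mono) simp
        also have "\<dots> = L / 2 * d" by (simp add: exp_minus)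
        finally show ?thesis by (simp add: q_def abs_mult flip: right_diff_distrib)
      qed
    qed simp
    then show "\<bar>A z t i - A y t i\<bar> \<le> d / 2" using \<open>L > 0\<close> by (simp add: A_def)
  qed
  then obtain y where y: "?adm y" and fix_y: "A y = y" by blast
  define x where "x t i = (if i < N then X i + exp (L * t) * y t i else 0)" for t i
  have y_V: "y t i = V y i t" if "t \<ge> 0" for t i
    using that fun_cong[OF fun_cong[OF fix_y], of t i] by (simp add: A_def)
  have "winfree_solution N P R \<kappa> \<omega> x"
    unfolding winfree_solution_iff
  proof (intro conjI allI impI)
    fix t :: real and i assume "0 \<le> t" "i < N"
    have "((\<lambda>t. X i + exp (L * t) * V y i t) has_real_derivative G (x t) i) (at t)"
    proof -
      have "exp (L * t) * q y i t = G (x t) i"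
        unfolding q_def G_def using \<open>i < N\<close>
        by (simp add: exp_minus x_def cong: winfree_field_cong)
      moreover have "((\<lambda>t. X i + exp (L * t) * V y i t) has_real_derivative
          exp (L * t) * q y i t) (at t)"
        by (auto intro!: derivative_eq_intros V[OF y] simp: algebra_simps)
      ultimately show ?thesis by simp
    qed
    then have "((\<lambda>t. X i + exp (L * t) * V y i t) has_real_derivative
        winfree_field N P R \<kappa> \<omega> (x t) i) (at t within {0..})"
      using \<open>i < N\<close> by (auto simp: G_def intro: has_field_derivative_at_within)
    then show "((\<lambda>s. x s i) has_real_derivative winfree_field N P R \<kappa> \<omega> (x t) i)
        (at t within {0..})"
      by (rule has_field_derivative_transform_within[where d = 1])
        (use \<open>0 \<le> t\<close> \<open>i < N\<close> y_V in \<open>auto simp: x_def\<close>)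
  qed (simp add: x_def)
  moreover have "x 0 = X"
    using X by (auto simp: x_def topspace_Euclidean_space y_V V0[OF y])
  ultimately show ?thesis by blast
qed

lemma DERIV_square:
  fixes f :: "real \<Rightarrow> real"
  shows "(f has_real_derivative d) (at x within S) \<Longrightarrow>
    ((\<lambda>x. (f x)\<^sup>2) has_real_derivative 2 * f x * d) (at x within S)"
  by (auto intro!: derivative_eq_intros)

text \<open>Gronwall's argument for the squared Euclidean distance \<open>D\<close>: every component
  difference is at most \<open>sqrt (D s)\<close>, so the sup-norm Lipschitz bound gives D' \<le> K
  D, and \<open>exp (- K * s) * D s\<close> decreases from the value 0.\<close>

lemma winfree_solution_unique:
  assumes bnd: "\<And>x. \<bar>P x\<bar> \<le> M" "\<And>x. \<bar>R x\<bar> \<le> M"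
    and lip: "\<And>x y. \<bar>P x - P y\<bar> \<le> M * \<bar>x - y\<bar>" "\<And>x y. \<bar>R x - R y\<bar> \<le> M * \<bar>x - y\<bar>"
    and "0 \<le> \<kappa>"
    and x: "winfree_solution N P R \<kappa> \<omega> x" and y: "winfree_solution N P R \<kappa> \<omega> y"
    and "x 0 = y 0" and "0 \<le> t"
  shows "x t = y t"
proof -
  define D where "D s = (\<Sum>i<N. (x s i - y s i)\<^sup>2)" for s
  define D' where "D' s = (\<Sum>i<N. 2 * (x s i - y s i) *
      (winfree_field N P R \<kappa> \<omega> (x s) i - winfree_field N P R \<kappa> \<omega> (y s) i))" for s
  define L where "L = 2 * \<kappa> * M\<^sup>2"
  define K where "K = 2 * real N * L"
  have D_der: "(D has_real_derivative D' s) (at s within {0..})" if "s \<ge> 0" for s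
    unfolding D_def D'_def
  proof (rule DERIV_sum)
    fix i assume "i \<in> {..<N}"
    then have "((\<lambda>s. x s i - y s i) has_real_derivative
        winfree_field N P R \<kappa> \<omega> (x s) i - winfree_field N P R \<kappa> \<omega> (y s) i)
        (at s within {0..})"
      using x y that unfolding winfree_solution_iff by (intro DERIV_diff) auto
    then show "((\<lambda>s. (x s i - y s i)\<^sup>2) has_real_derivative 2 * (x s i - y s i) *
      (winfree_field N P R \<kappa> \<omega> (x s) i - winfree_field N P R \<kappa> \<omega> (y s) i))
      (at s within {0..})"
      by (rule DERIV_square)
  qed
  have D'_le: "D' s \<le> K * D s" for s
  proof -
    have "D s \<ge> 0" by (simp add: D_def sum_nonneg)
    have comp: "\<bar>x s i - y s i\<bar> \<le> sqrt (D s)" if "i < N" for i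
    proof (rule real_le_rsqrt)
      show "\<bar>x s i - y s i\<bar>\<^sup>2 \<le> D s"
        unfolding D_def power2_abs
        by (rule member_le_sum[where f = "\<lambda>i. (x s i - y s i)\<^sup>2"]) (use that in auto)
    qed
    have "D' s \<le> (\<Sum>i<N. 2 * L * D s)"
      unfolding D'_def
    proof (rule sum_mono)
      fix i assume "i \<in> {..<N}"
      then have i: "i < N" by simp
      have "(x s i - y s i) *
          (winfree_field N P R \<kappa> \<omega> (x s) i - winfree_field N P R \<kappa> \<omega> (y s) i)
          \<le> \<bar>x s i - y s i\<bar> *
          \<bar>winfree_field N P R \<kappa> \<omega> (x s) i - winfree_field N P R \<kappa> \<omega> (y s) i\<bar>"
        by (metis abs_ge_self abs_mult)
      also have "\<dots> \<le> sqrt (D s) * (L * sqrt (D s))"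
        unfolding L_def using \<open>D s \<ge> 0\<close>
        by (intro mult_mono comp i winfree_field_lipschitz[OF bnd lip \<open>0 \<le> \<kappa>\<close> i]) auto
      also have "\<dots> = L * D s" using \<open>D s \<ge> 0\<close> by simp
      finally show "2 * (x s i - y s i) *
          (winfree_field N P R \<kappa> \<omega> (x s) i - winfree_field N P R \<kappa> \<omega> (y s) i) \<le> 2 * L * D s"
        by (simp only: mult.assoc)
    qed
    then show ?thesis by (simp add: K_def algebra_simps)
  qed
  have E_der: "((\<lambda>s. exp (- K * s) * D s) has_real_derivative exp (- K * s) * (D' s - K * D s))
      (at s within {0..})" if "s \<ge> 0" for s
  proof -
    have "((\<lambda>s. exp (- K * s)) has_real_derivative - K * exp (- K * s)) (at s within {0..})"
      by (auto intro!: derivative_eq_intros)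
    from DERIV_mult[OF this D_der[OF that]] show ?thesis
      by (rule DERIV_cong) (simp add: algebra_simps)
  qed
  \<comment> \<open>At time 0 only a one-sided derivative is available, so monotonicity is derived
    from the open interval together with continuity at its ends.\<close>
  have "exp (- K * 0) * D 0 \<ge> exp (- K * t) * D t"
  proof (rule DERIV_nonpos_imp_decreasing_open[OF \<open>0 \<le> t\<close>], intro exI conjI)
    fix s :: real assume "0 < s"
    then have at_s: "at s within {0..} = at s"
      by (intro at_within_interior) simp
    show "((\<lambda>s. exp (- K * s) * D s) has_real_derivative exp (- K * s) * (D' s - K * D s)) (at s)"
      by (rule E_der[OF less_imp_le[OF \<open>0 < s\<close>], unfolded at_s])
    show "exp (- K * s) * (D' s - K * D s) \<le> 0"
      using D'_le[of s] by (simp add: mult_nonneg_nonpos)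
  next
    have "continuous_on {0..} (\<lambda>s. exp (- K * s) * D s)"
      by (rule DERIV_continuous_on[OF E_der]) simp
    then show "continuous_on {0..t} (\<lambda>s. exp (- K * s) * D s)"
      by (rule continuous_on_subset) auto
  qed
  also have "exp (- K * 0) * D 0 = 0" by (simp add: D_def \<open>x 0 = y 0\<close>)
  finally have "D t \<le> 0" by (simp add: mult_le_0_iff)
  moreover have "D t \<ge> 0" by (simp add: D_def sum_nonneg)
  ultimately have "D t = 0" by simp
  then have "x t i = y t i" if "i < N" for i
    using that by (simp add: D_def sum_nonneg_eq_0_iff)
  moreover have "x t i = y t i" if "i \<ge> N" for i
    using x y that \<open>0 \<le> t\<close> by (simp add: winfree_solution_iff)
  ultimately show ?thesis by (intro ext) (meson not_le)
qed

section \<open>Invariance of the tube\<close>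

lemma sync_tube_iff:
  assumes "N \<ge> 1"
  shows "X \<in> sync_tube N \<Delta> \<longleftrightarrow>
    (\<forall>i\<ge>N. X i = 0) \<and> (\<forall>i<N. \<forall>j<N. X j - X i < \<Delta> (mean N X))"
proof -
  have "spread N X < d \<longleftrightarrow> (\<forall>i<N. \<forall>j<N. \<bar>X j - X i\<bar> < d)" for d
    unfolding spread_def using assms by (subst Max_less_iff) (auto simp: lessThan_empty_iff)
  also have "\<dots> d \<longleftrightarrow> (\<forall>i<N. \<forall>j<N. X j - X i < d)" for d
    by (auto simp: abs_less_iff)
  finally show ?thesis by (simp add: sync_tube_def topspace_Euclidean_space)
qed

lemma openin_sync_tube:
  assumes "N \<ge> 1" and "continuous_on UNIV \<Delta>"
  shows "openin (Euclidean_space N) (sync_tube N \<Delta>)"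
proof -
  let ?O = "\<Inter>i<N. \<Inter>j<N. {X :: nat \<Rightarrow> real. X j - X i < \<Delta> (mean N X)}"
  have coord: "continuous_on UNIV (\<lambda>X :: nat \<Rightarrow> real. X i)" for i
    by simp
  have "continuous_on UNIV (\<lambda>X. \<Delta> (mean N X))"
    by (rule continuous_on_compose2[OF assms(2)]) (auto intro!: continuous_intros coord)
  then have "open {X :: nat \<Rightarrow> real. X j - X i < \<Delta> (mean N X)}" for i j
    by (intro open_Collect_less continuous_on_diff coord)
  then have "open ?O" by (intro open_INT ballI) auto
  moreover have "sync_tube N \<Delta> = ?O \<inter> {x. \<forall>i\<ge>N. x i = 0}"
    by (auto simp: sync_tube_iff[OF assms(1)])
  ultimately show ?thesis
    by (auto simp: Euclidean_space_def openin_subtopology euclidean_product_topology)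
qed

text \<open>At the first exit time some difference \<open>x\<^sub>j - x\<^sub>i\<close> equals \<open>\<Delta>(mean x)\<close>, and by \<open>inward\<close> it was
  larger than \<open>\<Delta>(mean x)\<close> just before.\<close>

lemma sync_tube_invariant:
  assumes "N \<ge> 1" and \<Delta>: "\<And>s. (\<Delta> has_real_derivative \<Delta>' s) (at s)"
    and inward: "\<And>X i j. i < N \<Longrightarrow> j < N \<Longrightarrow>
      (\<And>k l. k < N \<Longrightarrow> l < N \<Longrightarrow> \<bar>X k - X l\<bar> \<le> \<Delta> (mean N X)) \<Longrightarrow> X j - X i = \<Delta> (mean N X) \<Longrightarrow>
      winfree_field N P R \<kappa> \<omega> X j - winfree_field N P R \<kappa> \<omega> X i
        < \<Delta>' (mean N X) * mean N (winfree_field N P R \<kappa> \<omega> X)"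
    and x: "winfree_solution N P R \<kappa> \<omega> x" and x0: "x 0 \<in> sync_tube N \<Delta>" and "0 \<le> t"
  shows "x t \<in> sync_tube N \<Delta>"
proof (rule ccontr)
  assume out: "x t \<notin> sync_tube N \<Delta>"
  define g where "g i j s = x s j - x s i - \<Delta> (mean N (x s))" for i j s
  define g' where "g' i j s = winfree_field N P R \<kappa> \<omega> (x s) j - winfree_field N P R \<kappa> \<omega> (x s) i
      - \<Delta>' (mean N (x s)) * mean N (winfree_field N P R \<kappa> \<omega> (x s))" for i j s
  have g_der: "(g i j has_real_derivative g' i j s) (at s within {0..})"
    if "i < N" "j < N" "s \<ge> 0" for i j s
    unfolding g_def g'_def using x that
    by (intro DERIV_diff DERIV_chain2[OF \<Delta>] has_real_derivative_mean)
      (auto simp: winfree_solution_iff)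
  have g_cont: "continuous_on {0..} (g i j)" if "i < N" "j < N" for i j
    by (rule DERIV_continuous_on[OF g_der[OF that]]) simp
  have in_iff: "x s \<in> sync_tube N \<Delta> \<longleftrightarrow> (\<forall>i<N. \<forall>j<N. g i j s < 0)" if "s \<ge> 0" for s
    using x that by (auto simp: sync_tube_iff[OF \<open>N \<ge> 1\<close>] g_def winfree_solution_iff)
  \<comment> \<open>The times at which the solution is outside the tube. As a finite union of closed
    sets \<open>S\<close> is closed, so its infimum is attained.\<close>
  define S where "S = (\<Union>i<N. \<Union>j<N. {s \<in> {0..}. 0 \<le> g i j s})"
  have S_iff: "s \<in> S \<longleftrightarrow> s \<ge> 0 \<and> x s \<notin> sync_tube N \<Delta>" for s
  proof
    show "s \<ge> 0 \<and> x s \<notin> sync_tube N \<Delta>" if "s \<in> S"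
      using that in_iff[of s] by (force simp: S_def)
    show "s \<in> S" if "s \<ge> 0 \<and> x s \<notin> sync_tube N \<Delta>"
      using that in_iff[of s] by (auto simp: S_def not_less)
  qed
  have "closed S"
    unfolding S_def
    by (intro closed_UN ballI continuous_on_closed_Collect_le) (auto intro!: g_cont)
  moreover have "S \<noteq> {}" using out \<open>0 \<le> t\<close> S_iff by blast
  moreover have bdd: "bdd_below S" by (rule bdd_belowI[of _ 0]) (simp add: S_iff)
  ultimately have "Inf S \<in> S" by (intro closed_contains_Inf)
  define T where "T = Inf S"
  have "T \<ge> 0" "x T \<notin> sync_tube N \<Delta>" using \<open>Inf S \<in> S\<close> by (auto simp: T_def S_iff)
  with x0 have "T > 0" by (metis order_le_less)
  have before: "g i j s < 0" if "0 \<le> s" "s < T" "i < N" "j < N" for i j s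
  proof -
    have "s \<notin> S" using cInf_lower[OF _ bdd, of s] that by (auto simp: T_def)
    then show ?thesis using that in_iff[of s] by (simp add: S_iff)
  qed
  have at_T: "at T within {0..} = at T"
    by (rule at_within_interior) (use \<open>T > 0\<close> in simp)
  \<comment> \<open>By continuity from the left the closed inequalities survive at the exit time;
    this is the hypothesis that \<open>inward\<close> asks of all pairs.\<close>
  have le: "g i j T \<le> 0" if "i < N" "j < N" for i j
  proof (rule tendsto_upperbound)
    have "isCont (g i j) T"
      by (rule DERIV_isCont[OF g_der[OF that \<open>T \<ge> 0\<close>, unfolded at_T]])
    then show "(g i j \<longlongrightarrow> g i j T) (at_left T)"
      unfolding isCont_def filterlim_at_split by blast
    have "\<forall>\<^sub>F s in at_left T. s \<in> {0<..<T}"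
      by (rule eventually_at_left_real) (fact \<open>T > 0\<close>)
    then show "\<forall>\<^sub>F s in at_left T. g i j s \<le> 0"
      by (rule eventually_mono) (use before that in \<open>auto intro: less_imp_le\<close>)
  qed simp
  obtain i j where ij: "i < N" "j < N" "0 \<le> g i j T"
    using \<open>x T \<notin> sync_tube N \<Delta>\<close> in_iff \<open>T \<ge> 0\<close> by (auto simp: not_less)
  have "g i j T = 0" using le[OF ij(1,2)] ij(3) by simp
  have "g' i j T < 0"
    unfolding g'_def
  proof (subst diff_less_0_iff_less, rule inward[OF ij(1,2)])
    show "\<bar>x T k - x T l\<bar> \<le> \<Delta> (mean N (x T))" if "k < N" "l < N" for k l
      using le[of k l] le[of l k] that by (auto simp: g_def)
    show "x T j - x T i = \<Delta> (mean N (x T))" using \<open>g i j T = 0\<close> by (simp add: g_def)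
  qed
  with DERIV_neg_dec_left[OF g_der[OF ij(1,2) \<open>T \<ge> 0\<close>, unfolded at_T]]
  obtain d where "d > 0" and d: "\<And>h. h > 0 \<Longrightarrow> h < d \<Longrightarrow> g i j T < g i j (T - h)"
    by blast
  define h where "h = min (d / 2) (T / 2)"
  have "h > 0" "h < d" "h < T" using \<open>d > 0\<close> \<open>T > 0\<close> by (auto simp: h_def min_def)
  then show False using d[of h] before[of "T - h" i j] ij \<open>g i j T = 0\<close> by simp
qed

section \<open>The vector field on the boundary of the tube\<close>

lemma real_mvt_bound:
  fixes f f' :: "real \<Rightarrow> real"
  assumes der: "\<And>x. (f has_real_derivative f' x) (at x)" and bnd: "\<And>x. \<bar>f' x\<bar> \<le> M"
  shows "\<bar>f x - f y\<bar> \<le> M * \<bar>x - y\<bar>"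
  using field_differentiable_bound[of UNIV f f' M y x] der bnd
  by (simp add: abs_minus_commute)

text \<open>The intermediate point lies between \<open>x\<close> and \<open>y\<close>, hence as
  close to \<open>c\<close> as they are. This allows \<open>f' \<xi>\<close> to be replaced by the
  derivative at \<open>c\<close>, up to a Lipschitz error.\<close>

lemma real_mvt_near:
  fixes f f' :: "real \<Rightarrow> real"
  assumes der: "\<And>x. (f has_real_derivative f' x) (at x)"
    and near: "\<bar>x - c\<bar> \<le> s" "\<bar>y - c\<bar> \<le> s"
  obtains \<xi> where "f x - f y = f' \<xi> * (x - y)" and "\<bar>\<xi> - c\<bar> \<le> s"
proof (cases x y rule: linorder_cases)
  case less
  from MVT2[OF this der] obtain z where z: "x < z" "z < y" "f y - f x = (y - x) * f' z" by blast
  show ?thesis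
  proof
    show "f x - f y = f' z * (x - y)" using z(3) by (simp add: algebra_simps)
    show "\<bar>z - c\<bar> \<le> s" using z near by linarith
  qed
next
  case greater
  from MVT2[OF this der] obtain z where z: "y < z" "z < x" "f x - f y = (x - y) * f' z" by blast
  show ?thesis
  proof
    show "f x - f y = f' z * (x - y)" using z(3) by (simp add: algebra_simps)
    show "\<bar>z - c\<bar> \<le> s" using z near by linarith
  qed
qed (use near that[of x] in simp)

text \<open>\<open>h\<close> solves the linearisation of \<open>x\<^sub>j - x\<^sub>i\<close> along the synchronised orbit at coupling \<open>\<kappa>0\<close>,
  with phase as time and the mean contraction rate \<open>c\<close> removed, so that \<open>h\<close> is periodic.\<close>

locale winfree_reference =
  fixes P P' R R' h :: "real \<Rightarrow> real" and \<kappa>0 m c M H :: real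
  assumes P_der: "\<And>x. (P has_real_derivative P' x) (at x)"
    and R_der: "\<And>x. (R has_real_derivative R' x) (at x)"
    and P_bnd: "\<And>x. \<bar>P x\<bar> \<le> M" and R_bnd: "\<And>x. \<bar>R x\<bar> \<le> M"
    and P'_bnd: "\<And>x. \<bar>P' x\<bar> \<le> M" and R'_bnd: "\<And>x. \<bar>R' x\<bar> \<le> M"
    and R'_lip: "\<And>x y. \<bar>R' x - R' y\<bar> \<le> M * \<bar>x - y\<bar>"
    and P_per: "\<And>x. P (x + 2 * pi) = P x" and R_per: "\<And>x. R (x + 2 * pi) = R x"
    and R'_per: "\<And>x. R' (x + 2 * pi) = R' x"
    and \<kappa>0_pos: "0 < \<kappa>0" and m_pos: "0 < m" and m_le: "\<And>x. m \<le> 1 - \<kappa>0 * P x * R x"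
    and c_pos: "0 < c"
    and h_der: "\<And>x. (h has_real_derivative
          (c - \<kappa>0 * P x * R' x / (1 - \<kappa>0 * P x * R x)) * h x) (at x)"
    and h_per: "\<And>x. h (x + 2 * pi) = h x"
    and H_ge: "1 \<le> H" and h_le: "\<And>x. h x \<le> H" and h_ge: "\<And>x. 1 / H \<le> h x"
begin

lemma M_nonneg: "0 \<le> M" using P_bnd[of 0] by linarith

lemma h_pos: "0 < h x"
  by (rule less_le_trans[OF _ h_ge]) (use H_ge in simp)

lemma P_lip: "\<bar>P x - P y\<bar> \<le> M * \<bar>x - y\<bar>"
  by (rule real_mvt_bound[OF P_der P'_bnd])

lemma R_lip: "\<bar>R x - R y\<bar> \<le> M * \<bar>x - y\<bar>"
  by (rule real_mvt_bound[OF R_der R'_bnd])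

text \<open>The logarithmic derivative of \<open>h\<close>, by \<open>h_der\<close>.\<close>

definition growth :: "real \<Rightarrow> real" where
  "growth x = c - \<kappa>0 * P x * R' x / (1 - \<kappa>0 * P x * R x)"

lemma growth_bnd: "\<bar>growth x\<bar> \<le> c + \<kappa>0 * M\<^sup>2 / m"
proof -
  have "\<bar>\<kappa>0 * P x * R' x\<bar> \<le> \<kappa>0 * M * M"
    unfolding abs_mult using \<kappa>0_pos M_nonneg P_bnd R'_bnd by (intro mult_mono) auto
  then have "\<bar>\<kappa>0 * P x * R' x\<bar> / \<bar>1 - \<kappa>0 * P x * R x\<bar> \<le> \<kappa>0 * M * M / m"
    using m_pos m_le[of x] \<kappa>0_pos M_nonneg by (intro frac_le) auto
  then have "\<bar>\<kappa>0 * P x * R' x / (1 - \<kappa>0 * P x * R x)\<bar> \<le> \<kappa>0 * M\<^sup>2 / m"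
    by (simp add: abs_divide power2_eq_square mult.assoc)
  then show ?thesis unfolding growth_def using c_pos by linarith
qed

lemma growth_mult:
  "growth x * (1 - \<kappa>0 * P x * R x) = c * (1 - \<kappa>0 * P x * R x) - \<kappa>0 * P x * R' x"
  using m_pos m_le[of x] by (simp add: growth_def left_diff_distrib)

text \<open>On the boundary the mean value theorem turns the left side into
  \<open>\<omega> j - \<omega> i\<close> minus \<open>\<delta> * \<kappa> * p * R' \<xi>\<close>.
  With all quantities replaced by their values at the mean phase and at \<open>\<kappa>0\<close>,
  \<open>growth_mult\<close> leaves a margin of at least \<open>\<delta> * c * m\<close>. The
  replacement costs \<open>C * (\<gamma> + \<eta> + \<delta>)\<close> on the left and
  \<open>B\<close> times as much on the right, where \<open>growth\<close> is a factor; what remains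
  of the margin must exceed the frequency gap \<open>2 * \<gamma>\<close>.\<close>

lemma boundary_estimate:
  fixes \<delta> \<gamma> \<eta> :: real
  defines "B \<equiv> c + \<kappa>0 * M\<^sup>2 / m" and "C \<equiv> 1 + M\<^sup>2 + 2 * \<kappa>0 * M\<^sup>2"
  assumes \<kappa>: "\<bar>\<kappa> - \<kappa>0\<bar> \<le> \<eta>" and \<omega>: "\<And>k. k < N \<Longrightarrow> \<bar>\<omega> k - 1\<bar> \<le> \<gamma>"
    and "0 < \<delta>" and i: "i < N" and j: "j < N"
    and spread: "\<And>k l. k < N \<Longrightarrow> l < N \<Longrightarrow> \<bar>X k - X l\<bar> \<le> \<delta>"
    and ij: "X j - X i = \<delta>"
    and small: "2 * \<gamma> < \<delta> * (c * m - (B + 1) * C * (\<gamma> + \<eta> + \<delta>))"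
  shows "winfree_field N P R \<kappa> \<omega> X j - winfree_field N P R \<kappa> \<omega> X i
      < growth (mean N X) * \<delta> * mean N (winfree_field N P R \<kappa> \<omega> X)"
proof -
  have N: "N \<ge> 1" using i by simp
  have "0 \<le> \<gamma>" using \<omega>[OF i] by linarith
  have "0 \<le> \<eta>" using \<kappa> by linarith
  have "0 \<le> B" using c_pos \<kappa>0_pos m_pos by (simp add: B_def)
  define \<mu> where "\<mu> = mean N X"
  define p where "p = mean N (\<lambda>k. P (X k))"
  define r where "r = mean N (\<lambda>k. R (X k))"
  define F where "F = mean N (winfree_field N P R \<kappa> \<omega> X)"
  define f where "f = 1 - \<kappa>0 * P \<mu> * R \<mu>"
  have near: "\<bar>X k - \<mu>\<bar> \<le> \<delta>" if "k < N" for k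
    using abs_mean_diff_const_le[OF N, of X "X k" \<delta>] spread that
    by (simp add: \<mu>_def abs_minus_commute)
  have Md: "M * \<bar>X k - \<mu>\<bar> \<le> M * \<delta>" if "k < N" for k
    using near[OF that] M_nonneg by (rule mult_left_mono)
  have p: "\<bar>p - P \<mu>\<bar> \<le> M * \<delta>"
    unfolding p_def by (rule abs_mean_diff_const_le[OF N]) (rule order_trans[OF P_lip Md])
  have r: "\<bar>r - R \<mu>\<bar> \<le> M * \<delta>"
    unfolding r_def by (rule abs_mean_diff_const_le[OF N]) (rule order_trans[OF R_lip Md])
  have "\<bar>p\<bar> \<le> M" unfolding p_def by (rule abs_mean_le) (use P_bnd M_nonneg in auto)
  have "\<bar>r\<bar> \<le> M" unfolding r_def by (rule abs_mean_le) (use R_bnd M_nonneg in auto)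
  have "\<bar>\<kappa>0 * P \<mu>\<bar> \<le> \<kappa>0 * M" using P_bnd[of \<mu>] \<kappa>0_pos by (simp add: abs_mult)
  \<comment> \<open>Error made in replacing the effective coupling \<open>\<kappa> * p\<close> by
    \<open>\<kappa>0 * P \<mu>\<close>.\<close>
  define E where "E = \<eta> * M + \<kappa>0 * (M * \<delta>)"
  have k: "\<bar>\<kappa> * p - \<kappa>0 * P \<mu>\<bar> \<le> E"
    unfolding E_def using \<kappa>0_pos by (intro abs_mult_diff_le \<kappa> \<open>\<bar>p\<bar> \<le> M\<close> p) auto
  have kr: "\<bar>\<kappa> * p * r - \<kappa>0 * P \<mu> * R \<mu>\<bar> \<le> E * M + \<kappa>0 * M * (M * \<delta>)"
    by (rule abs_mult_diff_le[OF k _ _ r]) fact+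
  obtain \<xi> where \<xi>: "R (X j) - R (X i) = R' \<xi> * (X j - X i)" "\<bar>\<xi> - \<mu>\<bar> \<le> \<delta>"
    by (rule real_mvt_near[OF R_der near[OF j] near[OF i]])
  have R'\<xi>: "\<bar>R' \<xi> - R' \<mu>\<bar> \<le> M * \<delta>"
    by (rule order_trans[OF R'_lip]) (use \<xi>(2) M_nonneg in \<open>auto intro: mult_left_mono\<close>)
  have kR': "\<bar>\<kappa> * p * R' \<xi> - \<kappa>0 * P \<mu> * R' \<mu>\<bar> \<le> E * M + \<kappa>0 * M * (M * \<delta>)"
    by (rule abs_mult_diff_le[OF k R'_bnd _ R'\<xi>]) fact
  have "\<bar>mean N \<omega> - 1\<bar> \<le> \<gamma>" by (rule abs_mean_diff_const_le[OF N \<omega>])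
  moreover have "F = mean N \<omega> - \<kappa> * p * r"
  proof -
    have "F = mean N (\<lambda>k. \<omega> k - \<kappa> * p * R (X k))"
      unfolding F_def p_def by (rule mean_cong) (simp add: winfree_field_def)
    also have "\<dots> = mean N \<omega> - \<kappa> * p * r"
      by (simp add: mean_def r_def sum_subtractf right_diff_distrib diff_divide_distrib
          sum_distrib_left[symmetric])
    finally show ?thesis .
  qed
  ultimately have F: "\<bar>F - f\<bar> \<le> \<gamma> + (E * M + \<kappa>0 * M * (M * \<delta>))"
    unfolding f_def using kr by linarith
  \<comment> \<open>\<open>C\<close> is chosen so that the difference of the two sides expands into
    non-negative terms; the summand \<open>\<gamma>\<close> accounts for the deviation of the mean
    frequency from 1.\<close>
  have E_le: "E * M + \<kappa>0 * M * (M * \<delta>) + \<gamma> \<le> C * (\<gamma> + \<eta> + \<delta>)"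
  proof -
    have "C * (\<gamma> + \<eta> + \<delta>) - (E * M + \<kappa>0 * M * (M * \<delta>) + \<gamma>) =
      \<eta> + \<delta> + M\<^sup>2 * (\<gamma> + \<delta>) + 2 * \<kappa>0 * M\<^sup>2 * (\<gamma> + \<eta>)"
      by (simp add: C_def E_def power2_eq_square algebra_simps)
    also have "\<dots> \<ge> 0" using \<open>0 \<le> \<gamma>\<close> \<open>0 \<le> \<eta>\<close> \<open>0 < \<delta>\<close> \<kappa>0_pos by simp
    finally show ?thesis by simp
  qed
  have "\<bar>growth \<mu> * (F - f)\<bar> \<le> B * (C * (\<gamma> + \<eta> + \<delta>))"
    unfolding abs_mult B_def using F E_le growth_bnd
    by (intro mult_mono) (auto intro: order_trans[OF abs_ge_zero])
  moreover have "growth \<mu> * f \<ge> c * m - \<kappa>0 * P \<mu> * R' \<mu>"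
    using growth_mult[of \<mu>] m_le[of \<mu>] c_pos by (simp add: f_def)
  ultimately have gF: "growth \<mu> * F \<ge> c * m - \<kappa>0 * P \<mu> * R' \<mu> - B * (C * (\<gamma> + \<eta> + \<delta>))"
    by (simp add: right_diff_distrib)
  have "- (\<kappa> * p * R' \<xi>) \<le> - (\<kappa>0 * P \<mu> * R' \<mu>) + C * (\<gamma> + \<eta> + \<delta>)"
    using kR' E_le \<open>0 \<le> \<gamma>\<close> by linarith
  also have "\<dots> \<le> growth \<mu> * F - (c * m - (B + 1) * C * (\<gamma> + \<eta> + \<delta>))"
    using gF by (simp add: algebra_simps)
  finally have "\<delta> * - (\<kappa> * p * R' \<xi>)
      \<le> \<delta> * (growth \<mu> * F - (c * m - (B + 1) * C * (\<gamma> + \<eta> + \<delta>)))"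
    by (rule mult_left_mono) (use \<open>0 < \<delta>\<close> in simp)
  moreover have "winfree_field N P R \<kappa> \<omega> X j - winfree_field N P R \<kappa> \<omega> X i
      = \<omega> j - \<omega> i + \<delta> * - (\<kappa> * p * R' \<xi>)"
  proof -
    have "winfree_field N P R \<kappa> \<omega> X j - winfree_field N P R \<kappa> \<omega> X i
        = \<omega> j - \<omega> i - \<kappa> * p * (R (X j) - R (X i))"
      by (simp add: winfree_field_def p_def[symmetric] right_diff_distrib)
    then show ?thesis using \<xi>(1) ij by simp
  qed
  moreover have "\<omega> j - \<omega> i \<le> 2 * \<gamma>" using \<omega>[OF i] \<omega>[OF j] by linarith
  ultimately show ?thesis
    using small by (simp add: \<mu>_def[symmetric] F_def[symmetric] algebra_simps)
qed

text \<open>The width \<epsilon> is fixed first and the parameter radius \<open>r\<close>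
  afterwards. The width uses up at most a quarter of the margin \<open>c * m\<close>, the parameters
  at most another quarter, and the remaining half, multiplied by the least width
  \<open>\<epsilon> / H\<close>, still exceeds \<open>2 * \<gamma>\<close>. All constants are free
  of \<open>N\<close> and \<open>\<omega>\<close>.\<close>

lemma tube_is_inward:
  obtains \<epsilon> r :: real where "0 < \<epsilon>" "0 < r" "\<And>s. \<epsilon> * h s < 1"
    and "\<And>\<gamma> \<kappa> N \<omega> X i j. \<gamma> < r \<Longrightarrow> \<bar>\<kappa> - \<kappa>0\<bar> < r \<Longrightarrow> (\<And>k. k < N \<Longrightarrow> \<bar>\<omega> k - 1\<bar> \<le> \<gamma>) \<Longrightarrow>
      i < N \<Longrightarrow> j < N \<Longrightarrow>
      (\<And>k l. k < N \<Longrightarrow> l < N \<Longrightarrow> \<bar>X k - X l\<bar> \<le> \<epsilon> * h (mean N X)) \<Longrightarrow> X j - X i = \<epsilon> * h (mean N X) \<Longrightarrow>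
      winfree_field N P R \<kappa> \<omega> X j - winfree_field N P R \<kappa> \<omega> X i
        < \<epsilon> * (growth (mean N X) * h (mean N X)) * mean N (winfree_field N P R \<kappa> \<omega> X)"
proof -
  define B where "B = c + \<kappa>0 * M\<^sup>2 / m"
  define C where "C = 1 + M\<^sup>2 + 2 * \<kappa>0 * M\<^sup>2"
  define D where "D = (B + 1) * C"
  have "B \<ge> 0" using c_pos \<kappa>0_pos m_pos by (simp add: B_def)
  moreover have "C > 0" using \<kappa>0_pos by (simp add: C_def add_pos_nonneg)
  ultimately have "D > 0" by (simp add: D_def)
  have cm: "c * m > 0" using c_pos m_pos by simp
  have H: "H > 0" using H_ge by simp
  \<comment> \<open>Division by \<open>H\<close> turns bounds on \<epsilon> into bounds on
    \<open>\<epsilon> * h s\<close>; the entry \<open>1 / 2\<close> keeps the width below 1.\<close>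
  define \<epsilon> where "\<epsilon> = min (1 / 2) (c * m / (4 * D)) / H"
  define r where "r = min (c * m / (8 * D)) (\<epsilon> / H * (c * m) / 4)"
  have "\<epsilon> > 0" using cm \<open>D > 0\<close> H by (simp add: \<epsilon>_def)
  have "r > 0" using cm \<open>D > 0\<close> H \<open>\<epsilon> > 0\<close> by (simp add: r_def)
  have eh: "\<epsilon> * h s \<le> min (1 / 2) (c * m / (4 * D))" for s
  proof -
    have "\<epsilon> * h s \<le> \<epsilon> * H" using h_le \<open>\<epsilon> > 0\<close> by simp
    then show ?thesis using H by (simp add: \<epsilon>_def)
  qed
  show ?thesis
  proof
    show "\<epsilon> * h s < 1" for s using eh[of s] by simp
  next
    fix \<gamma> \<kappa> :: real and N \<omega> X i j
    assume \<gamma>: "\<gamma> < r" and \<kappa>: "\<bar>\<kappa> - \<kappa>0\<bar> < r" and \<omega>: "\<And>k. k < N \<Longrightarrow> \<bar>\<omega> k - 1\<bar> \<le> \<gamma>"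
      and i: "i < N" and j: "j < N"
      and spread: "\<And>k l. k < N \<Longrightarrow> l < N \<Longrightarrow> \<bar>X k - X l\<bar> \<le> \<epsilon> * h (mean N X)"
      and ij: "X j - X i = \<epsilon> * h (mean N X)"
    define \<delta> where "\<delta> = \<epsilon> * h (mean N X)"
    have "\<delta> > 0" using \<open>\<epsilon> > 0\<close> h_pos by (simp add: \<delta>_def)
    have "\<delta> \<ge> \<epsilon> / H" using h_ge[of "mean N X"] \<open>\<epsilon> > 0\<close> mult_left_mono[of "1 / H" _ \<epsilon>]
      by (simp add: \<delta>_def)
    have "\<delta> \<le> c * m / (4 * D)" using eh by (simp add: \<delta>_def)
    moreover have "\<gamma> < c * m / (8 * D)" "\<bar>\<kappa> - \<kappa>0\<bar> < c * m / (8 * D)"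
      using \<gamma> \<kappa> by (auto simp: r_def)
    ultimately have "\<gamma> + \<bar>\<kappa> - \<kappa>0\<bar> + \<delta> \<le>
        c * m / (8 * D) + c * m / (8 * D) + c * m / (4 * D)"
      by linarith
    then have "D * (\<gamma> + \<bar>\<kappa> - \<kappa>0\<bar> + \<delta>) \<le>
        D * (c * m / (8 * D) + c * m / (8 * D) + c * m / (4 * D))"
      using \<open>D > 0\<close> by (intro mult_left_mono) auto
    also have "\<dots> = c * m / 2" using \<open>D > 0\<close> by (simp add: distrib_left)
    finally have "D * (\<gamma> + \<bar>\<kappa> - \<kappa>0\<bar> + \<delta>) \<le> c * m / 2" .
    then have "\<delta> * (c * m / 2) \<le> \<delta> * (c * m - D * (\<gamma> + \<bar>\<kappa> - \<kappa>0\<bar> + \<delta>))"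
      using \<open>\<delta> > 0\<close> by (intro mult_left_mono) auto
    moreover have "2 * \<gamma> < \<epsilon> / H * (c * m / 2)" using \<gamma> by (simp add: r_def)
    moreover have "\<epsilon> / H * (c * m / 2) \<le> \<delta> * (c * m / 2)"
      using \<open>\<delta> \<ge> \<epsilon> / H\<close> cm by (intro mult_right_mono) auto
    ultimately have small: "2 * \<gamma> < \<delta> * (c * m - D * (\<gamma> + \<bar>\<kappa> - \<kappa>0\<bar> + \<delta>))"
      by linarith
    have "winfree_field N P R \<kappa> \<omega> X j - winfree_field N P R \<kappa> \<omega> X i
      < growth (mean N X) * \<delta> * mean N (winfree_field N P R \<kappa> \<omega> X)"
      by (rule boundary_estimate[OF order_refl \<omega> \<open>\<delta> > 0\<close> i j])
        (use spread ij small in \<open>auto simp: \<delta>_def D_def B_def C_def\<close>)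
    then show "winfree_field N P R \<kappa> \<omega> X j - winfree_field N P R \<kappa> \<omega> X i
        < \<epsilon> * (growth (mean N X) * h (mean N X)) * mean N (winfree_field N P R \<kappa> \<omega> X)"
      by (simp add: \<delta>_def mult_ac)
  qed fact+
qed

end

section \<open>Periodic profiles in the phase variable\<close>

context winfree_reference
begin

text \<open>The speed of a virtual oscillator of natural frequency 1 driven by the mean field. Its
  phase, rather than the mean phase, serves as clock, so that the profiles \<open>z i\<close>
  interact only through the mean of \<open>P\<close>.\<close>

definition den :: "real \<Rightarrow> nat \<Rightarrow> real \<Rightarrow> (nat \<Rightarrow> real) \<Rightarrow> real" where
  "den \<kappa> N \<theta> z = 1 - \<kappa> * mean N (\<lambda>j. P (\<theta> + z j)) * R \<theta>"

text \<open>Along a solution \<open>x\<^sub>i = \<theta> + z\<^sub>i(\<theta>)\<close> whose phase moves with speed \<open>\<theta>' = den \<kappa> N \<theta> (z \<theta>)\<close>,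
  the derivative of \<open>z\<^sub>i\<close> with respect to \<open>\<theta>\<close> is \<open>profile_field\<close> with \<open>w = \<omega>\<^sub>i - 1\<close>.\<close>

definition profile_field ::
  "real \<Rightarrow> nat \<Rightarrow> real \<Rightarrow> real \<Rightarrow> (nat \<Rightarrow> real) \<Rightarrow> nat \<Rightarrow> real" where
  "profile_field \<kappa> N w \<theta> z i =
     (w - \<kappa> * mean N (\<lambda>j. P (\<theta> + z j)) * (R (\<theta> + z i) - R \<theta>)) / den \<kappa> N \<theta> z"

text \<open>\<open>- slope \<theta> * z i\<close> is the linearisation of
  \<open>profile_field\<close> at \<open>z = 0\<close>, \<open>w = 0\<close> and
  \<open>\<kappa> = \<kappa>0\<close>. It is diagonal: variations of the mean field are multiplied
  by terms that vanish there.\<close>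

definition slope :: "real \<Rightarrow> real" where
  "slope \<theta> = \<kappa>0 * P \<theta> / (1 - \<kappa>0 * P \<theta> * R \<theta>) * R' \<theta>"

lemma growth_eq: "growth \<theta> = c - slope \<theta>"
  by (simp add: growth_def slope_def)

lemma coupling_near:
  assumes "\<bar>\<kappa> - \<kappa>0\<bar> \<le> s" "N \<ge> 1" "\<And>j. \<bar>z j\<bar> \<le> s"
  shows "\<bar>\<kappa> * mean N (\<lambda>j. P (\<theta> + z j)) - \<kappa>0 * P \<theta>\<bar> \<le> (\<kappa>0 + 1) * M * s"
proof -
  have "\<bar>mean N (\<lambda>j. P (\<theta> + z j)) - P \<theta>\<bar> \<le> M * s"
  proof (rule abs_mean_diff_const_le[OF assms(2)])
    show "\<bar>P (\<theta> + z j) - P \<theta>\<bar> \<le> M * s" for j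
      using P_lip[of "\<theta> + z j" \<theta>] mult_left_mono[OF assms(3) M_nonneg, of j] by simp
  qed
  moreover have "\<bar>mean N (\<lambda>j. P (\<theta> + z j))\<bar> \<le> M"
    by (rule abs_mean_le) (use P_bnd M_nonneg in auto)
  ultimately have "\<bar>\<kappa> * mean N (\<lambda>j. P (\<theta> + z j)) - \<kappa>0 * P \<theta>\<bar> \<le> s * M + \<kappa>0 * (M * s)"
    using \<kappa>0_pos by (intro abs_mult_diff_le assms(1)) auto
  then show ?thesis by (simp add: algebra_simps)
qed

lemma den_ge:
  assumes "\<bar>\<kappa> - \<kappa>0\<bar> \<le> s" "N \<ge> 1" "\<And>j. \<bar>z j\<bar> \<le> s" and s: "(\<kappa>0 + 1) * M\<^sup>2 * s \<le> m / 2"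
  shows "m / 2 \<le> den \<kappa> N \<theta> z"
proof -
  have "\<bar>(\<kappa> * mean N (\<lambda>j. P (\<theta> + z j)) - \<kappa>0 * P \<theta>) * R \<theta>\<bar> \<le> (\<kappa>0 + 1) * M * s * M"
    unfolding abs_mult using coupling_near[OF assms(1-3)] R_bnd
    by (intro mult_mono) (auto intro: order_trans[OF abs_ge_zero])
  also have "\<dots> \<le> m / 2" using s by (simp add: power2_eq_square mult_ac)
  finally have "\<bar>\<kappa> * mean N (\<lambda>j. P (\<theta> + z j)) * R \<theta> - \<kappa>0 * P \<theta> * R \<theta>\<bar> \<le> m / 2"
    by (simp only: left_diff_distrib)
  then show ?thesis unfolding den_def using m_le[of \<theta>] by linarith
qed

text \<open>Once the linear part is removed, the Lipschitz constant is of order \<open>s\<close>.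
  The difference splits into four terms, each with a small factor: \<open>T1\<close> contains
  \<open>w\<close>, \<open>T2\<close> the increment of \<open>R\<close> over a distance at most
  \<open>s\<close>, \<open>T3\<close> the error of the effective coupling, and \<open>T4\<close> the
  first-order Taylor error of \<open>R\<close>. The bound \<open>q\<close> controls reciprocals of
  products of two denominators.\<close>

lemma profile_field_lipschitz:
  fixes s d :: real
  defines "q \<equiv> 4 / m\<^sup>2"
  assumes \<kappa>: "\<bar>\<kappa> - \<kappa>0\<bar> \<le> s" and "s \<le> 1" and N: "N \<ge> 1"
    and z: "\<And>j. \<bar>z j\<bar> \<le> s" and y: "\<And>j. \<bar>y j\<bar> \<le> s" and d: "\<And>j. \<bar>z j - y j\<bar> \<le> d"
    and s: "(\<kappa>0 + 1) * M\<^sup>2 * s \<le> m / 2" and w: "\<bar>w\<bar> \<le> s"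
  shows "\<bar>(profile_field \<kappa> N w \<theta> z i + slope \<theta> * z i) - (profile_field \<kappa> N w \<theta> y i + slope \<theta> * y i)\<bar>
    \<le> (3 * (\<kappa>0 + 1) * M\<^sup>2 * q + 2 * \<kappa>0 * M\<^sup>2 / m) * s * d"
proof -
  let ?K = "\<kappa>0 + 1"
  have "0 \<le> s" using w by linarith
  have "0 \<le> d" using d[of 0] by linarith
  have "0 \<le> q" by (simp add: q_def)
  have K: "\<bar>\<kappa>\<bar> \<le> ?K" using \<kappa> \<open>s \<le> 1\<close> \<kappa>0_pos by linarith
  note M0 = M_nonneg
  define k where "k = \<kappa> * mean N (\<lambda>j. P (\<theta> + z j))"
  define k' where "k' = \<kappa> * mean N (\<lambda>j. P (\<theta> + y j))"
  define D where "D = den \<kappa> N \<theta> z"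
  define D' where "D' = den \<kappa> N \<theta> y"
  define D0 where "D0 = 1 - \<kappa>0 * P \<theta> * R \<theta>"
  have D_eq: "D = 1 - k * R \<theta>" "D' = 1 - k' * R \<theta>"
    by (simp_all add: D_def D'_def den_def k_def k'_def)
  have D: "m / 2 \<le> D" unfolding D_def by (rule den_ge[OF \<kappa> N z s])
  have D': "m / 2 \<le> D'" unfolding D'_def by (rule den_ge[OF \<kappa> N y s])
  have D0: "m \<le> D0" unfolding D0_def by (rule m_le)
  have nz: "D > 0" "D' > 0" "D0 > 0" using D D' D0 m_pos by linarith+
  have q: "1 / (A * B) \<le> q" if "m / 2 \<le> A" "m / 2 \<le> B" for A B
  proof -
    have "(m / 2) * (m / 2) \<le> A * B" using that m_pos by (intro mult_mono) auto
    then have "1 / (A * B) \<le> 1 / ((m / 2) * (m / 2))"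
      using m_pos by (intro frac_le) auto
    then show ?thesis by (simp add: q_def power2_eq_square)
  qed
  have quot: "\<bar>e / (A * B)\<bar> \<le> E * q" if "\<bar>e\<bar> \<le> E" "m / 2 \<le> A" "m / 2 \<le> B" for e E A B
  proof -
    have "A * B > 0" using that m_pos by simp
    have "\<bar>e\<bar> * (1 / (A * B)) \<le> E * q"
      using that q[OF that(2,3)] \<open>A * B > 0\<close> by (intro mult_mono) auto
    then show ?thesis using \<open>A * B > 0\<close> by (simp add: abs_divide)
  qed
  have lipM: "M * \<bar>z j - y j\<bar> \<le> M * d" for j by (rule mult_left_mono[OF d M0])
  have kk': "\<bar>k - k'\<bar> \<le> ?K * (M * d)"
  proof -
    have "\<bar>mean N (\<lambda>j. P (\<theta> + z j)) - mean N (\<lambda>j. P (\<theta> + y j))\<bar> \<le> M * d"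
      using M0 \<open>0 \<le> d\<close> order_trans[OF P_lip, of "\<theta> + z _" "\<theta> + y _" "M * d"] lipM
      by (intro abs_mean_diff_le) auto
    then have "\<bar>\<kappa>\<bar> * \<bar>mean N (\<lambda>j. P (\<theta> + z j)) - mean N (\<lambda>j. P (\<theta> + y j))\<bar> \<le> ?K * (M * d)"
      using K by (intro mult_mono) auto
    then show ?thesis by (simp add: k_def k'_def abs_mult flip: right_diff_distrib)
  qed
  have k'0: "\<bar>k' - \<kappa>0 * P \<theta>\<bar> \<le> ?K * M * s"
    unfolding k'_def by (rule coupling_near[OF \<kappa> N y])
  define T1 where "T1 = w * (1 / D - 1 / D')"
  define T2 where "T2 = (k / D - k' / D') * (R (\<theta> + z i) - R \<theta>)"
  define T3 where "T3 = (k' / D' - \<kappa>0 * P \<theta> / D0) * (R (\<theta> + z i) - R (\<theta> + y i))"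
  define T4 where "T4 = \<kappa>0 * P \<theta> / D0 * (R (\<theta> + z i) - R (\<theta> + y i) - R' \<theta> * (z i - y i))"
  have split: "(profile_field \<kappa> N w \<theta> z i + slope \<theta> * z i) -
      (profile_field \<kappa> N w \<theta> y i + slope \<theta> * y i) = T1 - T2 - T3 - T4"
  proof -
    have "profile_field \<kappa> N w \<theta> z i = w * (1 / D) - k / D * (R (\<theta> + z i) - R \<theta>)"
      "profile_field \<kappa> N w \<theta> y i = w * (1 / D') - k' / D' * (R (\<theta> + y i) - R \<theta>)"
      by (simp_all add: profile_field_def D_def D'_def k_def k'_def diff_divide_distrib)
    moreover have "slope \<theta> = \<kappa>0 * P \<theta> / D0 * R' \<theta>" by (simp add: slope_def D0_def)
    ultimately show ?thesis unfolding T1_def T2_def T3_def T4_def by algebra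
  qed
  have T1: "\<bar>T1\<bar> \<le> s * (?K * (M * d) * M * q)"
  proof -
    have "1 / D - 1 / D' = ((k - k') * R \<theta>) / (D * D')"
      using nz by (simp add: field_simps) (simp add: D_eq algebra_simps)
    also have "\<bar>\<dots>\<bar> \<le> ?K * (M * d) * M * q"
      unfolding abs_mult[of "k - k'" "R \<theta>", symmetric]
      by (rule quot[OF _ D D']) (unfold abs_mult, intro mult_mono kk' R_bnd,
        use \<open>0 \<le> d\<close> M0 \<kappa>0_pos in auto)
    finally show ?thesis unfolding T1_def abs_mult using w by (intro mult_mono) auto
  qed
  have Rz: "\<bar>R (\<theta> + z i) - R \<theta>\<bar> \<le> M * s"
    using R_lip[of "\<theta> + z i" \<theta>] mult_left_mono[OF z M0, of i] by simp
  have Rzy: "\<bar>R (\<theta> + z i) - R (\<theta> + y i)\<bar> \<le> M * d"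
    using R_lip[of "\<theta> + z i" "\<theta> + y i"] lipM[of i] by simp
  have T2: "\<bar>T2\<bar> \<le> ?K * (M * d) * q * (M * s)"
  proof -
    \<comment> \<open>Both denominators have the form 1 - k R(\<theta>) with the same
      \<open>R \<theta>\<close>, so the cross terms cancel and the numerator is just
      \<open>k - k'\<close>.\<close>
    have "k / D - k' / D' = (k - k') / (D * D')"
      using nz by (simp add: field_simps) (simp add: D_eq algebra_simps)
    also have "\<bar>\<dots>\<bar> \<le> ?K * (M * d) * q" by (rule quot[OF kk' D D'])
    finally show ?thesis unfolding T2_def abs_mult using Rz
      by (intro mult_mono) (auto intro: order_trans[OF abs_ge_zero])
  qed
  have T3: "\<bar>T3\<bar> \<le> ?K * M * s * q * (M * d)"
  proof -
    have "k' / D' - \<kappa>0 * P \<theta> / D0 = (k' - \<kappa>0 * P \<theta>) / (D' * D0)"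
      using nz by (simp add: field_simps) (simp add: D_eq D0_def algebra_simps)
    also have "\<bar>\<dots>\<bar> \<le> ?K * M * s * q" by (rule quot[OF k'0 D']) (use D0 m_pos in linarith)
    finally show ?thesis unfolding T3_def abs_mult using Rzy
      by (intro mult_mono) (auto intro: order_trans[OF abs_ge_zero])
  qed
  have T4: "\<bar>T4\<bar> \<le> \<kappa>0 * M / m * (M * s * d)"
  proof -
    have "\<bar>\<theta> + z i - \<theta>\<bar> \<le> s" "\<bar>\<theta> + y i - \<theta>\<bar> \<le> s" using z y by auto
    then obtain \<xi> where \<xi>: "R (\<theta> + z i) - R (\<theta> + y i) = R' \<xi> * ((\<theta> + z i) - (\<theta> + y i))"
      "\<bar>\<xi> - \<theta>\<bar> \<le> s"
      using real_mvt_near[OF R_der] by metis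
    have "R (\<theta> + z i) - R (\<theta> + y i) - R' \<theta> * (z i - y i) = (R' \<xi> - R' \<theta>) * (z i - y i)"
      unfolding \<xi>(1) by (simp add: algebra_simps)
    also have "\<bar>\<dots>\<bar> \<le> M * s * d"
      unfolding abs_mult using R'_lip[of \<xi> \<theta>] mult_left_mono[OF \<xi>(2) M0] d
      by (intro mult_mono) (auto intro: order_trans[OF abs_ge_zero])
    finally have *: "\<bar>R (\<theta> + z i) - R (\<theta> + y i) - R' \<theta> * (z i - y i)\<bar> \<le> M * s * d" .
    have "\<bar>\<kappa>0 * P \<theta>\<bar> / \<bar>D0\<bar> \<le> \<kappa>0 * M / m"
      using D0 m_pos \<kappa>0_pos P_bnd[of \<theta>] M0 by (intro frac_le) (auto simp: abs_mult)
    then show ?thesis unfolding T4_def abs_mult[of "\<kappa>0 * P \<theta> / D0"] abs_divide using * \<kappa>0_pos M0 m_pos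
      by (intro mult_mono) (auto intro: order_trans[OF abs_ge_zero])
  qed
  have "\<bar>T1 - T2 - T3 - T4\<bar> \<le> 3 * ?K * M\<^sup>2 * q * s * d + \<kappa>0 * M\<^sup>2 / m * s * d"
    using T1 T2 T3 T4 by (simp add: power2_eq_square algebra_simps abs_le_iff)
  also have "\<kappa>0 * M\<^sup>2 / m * s * d \<le> 2 * \<kappa>0 * M\<^sup>2 / m * s * d"
    using \<open>0 \<le> s\<close> \<open>0 \<le> d\<close> \<kappa>0_pos m_pos by (intro mult_right_mono divide_right_mono) auto
  finally show ?thesis unfolding split by (simp add: distrib_right)
qed

text \<open>In the variables \<open>u = z / h\<close> the linear part becomes the constant damping
  \<open>- c * u\<close>. The map sending \<open>u\<close> to the periodic solution of v' = q(u) - c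
  v is a contraction, since \<open>q\<close> has Lipschitz constant at most \<open>c / 2\<close>. As
  \<open>h\<close> lies between \<open>1 / H\<close> and \<open>H\<close>, passing between
  \<open>u\<close> and \<open>z\<close> costs only powers of \<open>H\<close>.\<close>

lemma profile_exists:
  assumes "0 < \<sigma>"
  obtains r :: real where "0 < r"
    and "\<And>\<gamma> \<kappa> N \<omega>. \<gamma> < r \<Longrightarrow> \<bar>\<kappa> - \<kappa>0\<bar> < r \<Longrightarrow> N \<ge> 1 \<Longrightarrow> (\<And>i. i < N \<Longrightarrow> \<bar>\<omega> i - 1\<bar> \<le> \<gamma>) \<Longrightarrow>
      \<exists>z. (\<forall>\<theta> i. \<bar>z \<theta> i\<bar> \<le> \<sigma>) \<and> (\<forall>\<theta> i. z (\<theta> + 2 * pi) i = z \<theta> i) \<and>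
        (\<forall>\<theta>. m / 2 \<le> den \<kappa> N \<theta> (z \<theta>)) \<and>
        (\<forall>\<theta>. \<forall>i<N. ((\<lambda>\<theta>. z \<theta> i) has_real_derivative
            profile_field \<kappa> N (\<omega> i - 1) \<theta> (z \<theta>) i) (at \<theta>))"
proof -
  define C where "C = 3 * (\<kappa>0 + 1) * M\<^sup>2 * (4 / m\<^sup>2) + 2 * \<kappa>0 * M\<^sup>2 / m"
  have "C \<ge> 0" using \<kappa>0_pos m_pos by (simp add: C_def)
  have H: "H > 0" using H_ge by simp
  \<comment> \<open>The four entries serve, in order, the required bound on the profile, the
    estimate \<kappa> \<le> \<kappa>0 + 1, the lower bound on \<open>den\<close>, and the Lipschitz
    constant \<open>c / 2\<close> of \<open>q\<close>.\<close>
  define s where "s = Min {\<sigma>, 1, m / (2 * (\<kappa>0 + 1) * (M\<^sup>2 + 1)), c / (2 * H\<^sup>2 * (C + 1))}"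
  have "s > 0" using assms m_pos c_pos \<kappa>0_pos H \<open>C \<ge> 0\<close>
    by (auto simp: s_def intro!: divide_pos_pos mult_pos_pos add_nonneg_pos)
  have "s \<le> \<sigma>" "s \<le> 1" and s3: "s \<le> m / (2 * (\<kappa>0 + 1) * (M\<^sup>2 + 1))"
    and s4: "s \<le> c / (2 * H\<^sup>2 * (C + 1))"
    by (auto simp: s_def)
  have s_den: "(\<kappa>0 + 1) * M\<^sup>2 * s \<le> m / 2"
  proof -
    have pos: "2 * (\<kappa>0 + 1) * (M\<^sup>2 + 1) > 0"
      using \<kappa>0_pos by (intro mult_pos_pos add_nonneg_pos) auto
    have "(\<kappa>0 + 1) * M\<^sup>2 * s \<le> (\<kappa>0 + 1) * (M\<^sup>2 + 1) * s"
      using \<kappa>0_pos \<open>s > 0\<close> by (intro mult_right_mono mult_left_mono) auto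
    also have "\<dots> = s * (2 * (\<kappa>0 + 1) * (M\<^sup>2 + 1)) / 2" by simp
    also have "\<dots> \<le> m / 2"
      using pos_le_divide_eq[OF pos, THEN iffD1, OF s3] by (rule divide_right_mono) simp
    finally show ?thesis .
  qed
  have s_lip: "H\<^sup>2 * C * s \<le> c / 2"
  proof -
    have pos: "2 * H\<^sup>2 * (C + 1) > 0" using H \<open>C \<ge> 0\<close> by simp
    have "H\<^sup>2 * C * s \<le> H\<^sup>2 * (C + 1) * s"
      using \<open>s > 0\<close> by (intro mult_right_mono mult_left_mono) auto
    also have "\<dots> = s * (2 * H\<^sup>2 * (C + 1)) / 2" by simp
    also have "\<dots> \<le> c / 2"
      using pos_le_divide_eq[OF pos, THEN iffD1, OF s4] by (rule divide_right_mono) simp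
    finally show ?thesis .
  qed
  \<comment> \<open>The radius in the variable \<open>u\<close> for which \<open>h * u\<close> stays
    within \<open>s\<close>.\<close>
  define \<rho> where "\<rho> = s / H"
  \<comment> \<open>The second entry makes the forcing at \<open>u = 0\<close>, which comes from the
    natural frequencies alone, at most \<open>c * \<rho> / 2\<close>.\<close>
  define r where "r = min s (c * \<rho> * m / (4 * H))"
  have "\<rho> > 0" using \<open>s > 0\<close> H by (simp add: \<rho>_def)
  have "r > 0" using \<open>s > 0\<close> \<open>\<rho> > 0\<close> c_pos m_pos H by (simp add: r_def)
  have hi: "\<bar>h \<theta>\<bar> \<le> H" for \<theta> using h_le[of \<theta>] h_pos[of \<theta>] by simp
  have hinv: "\<bar>1 / h \<theta>\<bar> \<le> H" for \<theta>
    using h_ge[of \<theta>] h_pos[of \<theta>] H by (simp add: divide_le_eq mult.commute)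
  have cont: "continuous_on UNIV P" "continuous_on UNIV R" "continuous_on UNIV R'" "continuous_on UNIV h"
  proof -
    show "continuous_on UNIV P" "continuous_on UNIV R" "continuous_on UNIV h"
      by (rule DERIV_continuous_on, rule has_field_derivative_at_within, rule P_der R_der h_der)+
    have "M-lipschitz_on UNIV R'"
      using R'_lip M_nonneg by (intro lipschitz_onI) (auto simp: dist_real_def)
    then show "continuous_on UNIV R'" by (rule lipschitz_on_continuous_on)
  qed
  show ?thesis
  proof
    fix \<gamma> \<kappa> :: real and N :: nat and \<omega> :: "nat \<Rightarrow> real"
    assume \<gamma>: "\<gamma> < r" and \<kappa>r: "\<bar>\<kappa> - \<kappa>0\<bar> < r" and N: "N \<ge> 1" and \<omega>: "\<And>i. i < N \<Longrightarrow> \<bar>\<omega> i - 1\<bar> \<le> \<gamma>"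
    have \<kappa>: "\<bar>\<kappa> - \<kappa>0\<bar> \<le> s" using \<kappa>r by (simp add: r_def)
    \<comment> \<open>Indices beyond \<open>N\<close> receive frequency deviation 0, so that the
      estimates hold for every index and the fixed point can be sought among functions on all of
      \<open>nat\<close>.\<close>
    define w where "w i = (if i < N then \<omega> i - 1 else 0)" for i
    have w_r: "\<bar>w i\<bar> \<le> r" for i using \<omega>[of i] \<gamma> \<open>r > 0\<close> by (auto simp: w_def)
    have w: "\<bar>w i\<bar> \<le> s" for i by (rule order_trans[OF w_r]) (simp add: r_def)
    define Z where "Z u \<theta> i = h \<theta> * u \<theta> i" for u :: "real \<Rightarrow> nat \<Rightarrow> real" and \<theta> i
    define q where "q u i \<theta> = (profile_field \<kappa> N (w i) \<theta> (Z u \<theta>) i + slope \<theta> * Z u \<theta> i) / h \<theta>"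
      for u i \<theta>
    let ?adm = "bounded_periodic \<rho> (2 * pi) :: (real \<Rightarrow> nat \<Rightarrow> real) \<Rightarrow> bool"
    have Z_bnd: "\<bar>Z u \<theta> i\<bar> \<le> s" if "\<bar>u \<theta> i\<bar> \<le> \<rho>" for u \<theta> i
    proof -
      have "\<bar>Z u \<theta> i\<bar> \<le> H * \<rho>"
        unfolding Z_def abs_mult using hi that H by (intro mult_mono) auto
      then show ?thesis using H by (simp add: \<rho>_def)
    qed
    have q_lip: "\<bar>q u i \<theta> - q v i \<theta>\<bar> \<le> c / 2 * d"
      if u: "\<And>i. \<bar>u \<theta> i\<bar> \<le> \<rho>" and v: "\<And>i. \<bar>v \<theta> i\<bar> \<le> \<rho>" and d: "\<And>i. \<bar>u \<theta> i - v \<theta> i\<bar> \<le> d" for u v i \<theta> d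
    proof -
      have "0 \<le> d" using d[of 0] by linarith
      have dZ: "\<bar>Z u \<theta> j - Z v \<theta> j\<bar> \<le> H * d" for j
      proof -
        have "\<bar>h \<theta>\<bar> * \<bar>u \<theta> j - v \<theta> j\<bar> \<le> H * d"
          using hi d H by (intro mult_mono) auto
        then show ?thesis by (simp add: Z_def abs_mult flip: right_diff_distrib)
      qed
      have "q u i \<theta> - q v i \<theta> = (1 / h \<theta>) *
          ((profile_field \<kappa> N (w i) \<theta> (Z u \<theta>) i + slope \<theta> * Z u \<theta> i)
          - (profile_field \<kappa> N (w i) \<theta> (Z v \<theta>) i + slope \<theta> * Z v \<theta> i))"
        by (simp add: q_def diff_divide_distrib)
      also have "\<bar>\<dots>\<bar> \<le> H * (C * s * (H * d))"
        unfolding abs_mult C_def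
        by (intro mult_mono hinv
            profile_field_lipschitz[OF \<kappa> \<open>s \<le> 1\<close> N Z_bnd[where u = u and \<theta> = \<theta>, OF u] Z_bnd[where u = v and \<theta> = \<theta>, OF v] dZ s_den w])
          (use H in auto)
      also have "\<dots> = (H\<^sup>2 * C * s) * d" by (simp add: power2_eq_square mult_ac)
      also have "\<dots> \<le> c / 2 * d" using s_lip \<open>0 \<le> d\<close> by (rule mult_right_mono)
      finally show ?thesis .
    qed
    \<comment> \<open>Half of the bound comes from the value at \<open>u = 0\<close>, the other half
      from the Lipschitz constant \<open>c / 2\<close> over the distance \<open>\<rho>\<close>.
      Hence the periodic solution operator maps the ball of radius \<open>\<rho>\<close> into
      itself.\<close>
    have q_bnd: "\<bar>q u i \<theta>\<bar> \<le> c * \<rho>" if u: "\<And>i. \<bar>u \<theta> i\<bar> \<le> \<rho>" for u i \<theta>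
    proof -
      let ?zero = "\<lambda>_ _. 0 :: real"
      have D: "m / 2 \<le> den \<kappa> N \<theta> (\<lambda>_. 0)"
        by (rule den_ge[OF \<kappa> N _ s_den]) (use \<open>s > 0\<close> in simp)
      have "Z ?zero \<theta> = (\<lambda>_. 0)" by (simp add: Z_def fun_eq_iff)
      then have "q ?zero i \<theta> = (1 / h \<theta>) * (w i / den \<kappa> N \<theta> (\<lambda>_. 0))"
        by (simp add: q_def profile_field_def)
      also have "\<bar>\<dots>\<bar> \<le> H * (r / (m / 2))"
        unfolding abs_mult abs_divide[of "w i"] using D m_pos w_r H \<open>r > 0\<close>
        by (intro mult_mono hinv frac_le) auto
      also have "\<dots> \<le> H * (c * \<rho> * m / (4 * H) / (m / 2))"
        using H m_pos by (intro mult_left_mono divide_right_mono) (auto simp: r_def)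
      also have "\<dots> = c * \<rho> / 2" using H m_pos by simp
      finally have "\<bar>q ?zero i \<theta>\<bar> \<le> c * \<rho> / 2" .
      moreover have "\<bar>q u i \<theta> - q ?zero i \<theta>\<bar> \<le> c / 2 * \<rho>"
        by (rule q_lip[where u = u and v = "?zero" and \<theta> = \<theta>, OF u]) (use \<open>\<rho> > 0\<close> u in auto)
      ultimately show ?thesis by linarith
    qed
    have q_cont: "continuous_on UNIV (q u i)" if "?adm u" for u i
    proof -
      have u: "continuous_on UNIV (\<lambda>\<theta>. u \<theta> j)" "\<bar>u \<theta> j\<bar> \<le> \<rho>" for j \<theta>
        using that by (auto simp: bounded_periodic_def)
      have Zc: "continuous_on UNIV (\<lambda>\<theta>. Z u \<theta> j)" for j
        unfolding Z_def by (intro continuous_intros cont u)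
      have "m / 2 \<le> den \<kappa> N \<theta> (Z u \<theta>)" for \<theta>
        by (rule den_ge[OF \<kappa> N Z_bnd[where u = u, OF u(2)] s_den])
      then have "den \<kappa> N \<theta> (Z u \<theta>) \<noteq> 0" for \<theta>
        using m_pos by (metis half_gt_zero not_le)
      moreover have "h \<theta> \<noteq> 0" "1 - \<kappa>0 * P \<theta> * R \<theta> \<noteq> 0" for \<theta>
        using h_pos[of \<theta>] m_le[of \<theta>] m_pos by auto
      moreover have "continuous_on UNIV (\<lambda>\<theta>. P (\<theta> + Z u \<theta> j))" for j
        by (rule continuous_on_compose2[OF cont(1)]) (auto intro!: continuous_intros Zc)
      moreover have "continuous_on UNIV (\<lambda>\<theta>. R (\<theta> + Z u \<theta> j))" for j
        by (rule continuous_on_compose2[OF cont(2)]) (auto intro!: continuous_intros Zc)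
      ultimately show ?thesis
        unfolding q_def profile_field_def slope_def
        by (intro continuous_intros cont Zc ballI) (auto simp: den_def intro!: continuous_intros cont)
    qed
    have q_per: "q u i (\<theta> + 2 * pi) = q u i \<theta>" if "?adm u" for u i \<theta>
    proof -
      have "u (\<theta> + 2 * pi) = u \<theta>" using that by (auto simp: bounded_periodic_def)
      then have "Z u (\<theta> + 2 * pi) = Z u \<theta>" by (auto simp: Z_def h_per)
      moreover have "P (\<theta> + 2 * pi + x) = P (\<theta> + x)" "R (\<theta> + 2 * pi + x) = R (\<theta> + x)" for x
        using P_per[of "\<theta> + x"] R_per[of "\<theta> + x"] by (simp_all add: ac_simps)
      ultimately show ?thesis
        by (simp add: q_def h_per profile_field_def den_def slope_def P_per R_per R'_per)
    qed
    define V where "V u i = (SOME v. (\<forall>\<theta>. (v has_real_derivative q u i \<theta> - c * v \<theta>) (at \<theta>)) \<and>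
        (\<forall>\<theta>. v (\<theta> + 2 * pi) = v \<theta>))" for u i
    have V_ex: "(\<forall>\<theta>. (V u i has_real_derivative q u i \<theta> - c * V u i \<theta>) (at \<theta>)) \<and>
        (\<forall>\<theta>. V u i (\<theta> + 2 * pi) = V u i \<theta>)" if "?adm u" for u i
    proof -
      from periodic_linear_ode_solution[OF q_cont[OF that] q_per[OF that] c_pos]
      have "\<exists>v. (\<forall>\<theta>. (v has_real_derivative q u i \<theta> - c * v \<theta>) (at \<theta>)) \<and>
        (\<forall>\<theta>. v (\<theta> + 2 * pi) = v \<theta>)" by (metis pi_gt_zero zero_less_mult_iff zero_less_numeral)
      from someI_ex[OF this] show ?thesis unfolding V_def .
    qed
    have V: "(V u i has_real_derivative q u i \<theta> - c * V u i \<theta>) (at \<theta>)"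
      and V_per: "V u i (\<theta> + 2 * pi) = V u i \<theta>" if "?adm u" for u i \<theta>
      using V_ex[OF that] by blast+
    define A where "A u \<theta> i = V u i \<theta>" for u \<theta> i
    have pi2: "2 * pi > 0" by simp
    have adm_bnd: "\<bar>u \<theta> i\<bar> \<le> \<rho>" if "?adm u" for u \<theta> i using that by (simp add: bounded_periodic_def)
    have "\<exists>u. ?adm u \<and> A u = u"
    proof (rule fixpoint_of_sup_contraction)
      show "0 \<le> \<rho>" using \<open>\<rho> > 0\<close> by simp
    next
      fix u assume u: "?adm u"
      have "\<bar>V u i \<theta>\<bar> \<le> c * \<rho> / c" for i \<theta>
        by (rule periodic_linear_ode_bound[OF c_pos pi2 V[OF u] V_per[OF u] q_bnd[where u = u, OF adm_bnd[OF u]]])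
      then have bnd: "\<bar>V u i \<theta>\<bar> \<le> \<rho>" for i \<theta> using c_pos by simp
      have cont_V: "continuous_on UNIV (V u i)" for i
        by (rule DERIV_continuous_on[OF has_field_derivative_at_within[OF V[OF u]]])
      show "?adm (A u)"
        unfolding bounded_periodic_def A_def by (intro conjI allI cont_V bnd V_per[OF u])
    next
      fix u v d \<theta> i assume u: "?adm u" and v: "?adm v" and d: "\<And>\<theta> i. \<bar>u \<theta> i - v \<theta> i\<bar> \<le> d"
      have "\<bar>V u i \<theta> - V v i \<theta>\<bar> \<le> (c / 2 * d) / c"
      proof (rule periodic_linear_ode_bound[OF c_pos pi2, where w = "\<lambda>\<theta>. V u i \<theta> - V v i \<theta>"])
        show "((\<lambda>\<theta>. V u i \<theta> - V v i \<theta>) has_real_derivative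
            (q u i t - q v i t) - c * (V u i t - V v i t)) (at t)" for t
          using DERIV_diff[OF V[OF u] V[OF v]] by (simp add: algebra_simps)
        show "\<bar>q u i t - q v i t\<bar> \<le> c / 2 * d" for t
          by (rule q_lip[where u = u and v = v, OF adm_bnd[OF u] adm_bnd[OF v] d])
      qed (simp add: V_per u v)
      then show "\<bar>A u \<theta> i - A v \<theta> i\<bar> \<le> d / 2" using c_pos by (simp add: A_def)
    qed
    then obtain u where u: "?adm u" and fix_u: "A u = u" by blast
    have u_der: "((\<lambda>\<theta>. u \<theta> i) has_real_derivative q u i \<theta> - c * u \<theta> i) (at \<theta>)" for i \<theta>
    proof -
      have "V u i = (\<lambda>\<theta>. u \<theta> i)" 
        using fun_cong[OF fun_cong[OF fix_u]] by (intro ext) (simp only: A_def)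
      with V[OF u, of i \<theta>] show ?thesis by simp
    qed
    \<comment> \<open>Multiplying by \<open>h\<close> undoes the change of variables: since
      \<open>growth\<close> is \<open>c - slope\<close>, the damping and the slope added in
      \<open>q\<close> both cancel.\<close>
    have Z_der: "((\<lambda>\<theta>. Z u \<theta> i) has_real_derivative profile_field \<kappa> N (w i) \<theta> (Z u \<theta>) i) (at \<theta>)"
      for i \<theta>
    proof -
      have "(h has_real_derivative growth \<theta> * h \<theta>) (at \<theta>)"
        using h_der unfolding growth_def .
      from DERIV_mult[OF this u_der[of i]]
      have "((\<lambda>\<theta>. Z u \<theta> i) has_real_derivative
          growth \<theta> * h \<theta> * u \<theta> i + (q u i \<theta> - c * u \<theta> i) * h \<theta>) (at \<theta>)"
        by (simp add: Z_def)
      moreover have "q u i \<theta> * h \<theta> = profile_field \<kappa> N (w i) \<theta> (Z u \<theta>) i + slope \<theta> * Z u \<theta> i"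
        using h_pos[of \<theta>] by (simp add: q_def)
      then have "growth \<theta> * h \<theta> * u \<theta> i + (q u i \<theta> - c * u \<theta> i) * h \<theta>
          = profile_field \<kappa> N (w i) \<theta> (Z u \<theta>) i"
        by (simp add: growth_eq Z_def algebra_simps)
      ultimately show ?thesis by simp
    qed
    show "\<exists>z. (\<forall>\<theta> i. \<bar>z \<theta> i\<bar> \<le> \<sigma>) \<and> (\<forall>\<theta> i. z (\<theta> + 2 * pi) i = z \<theta> i) \<and>
        (\<forall>\<theta>. m / 2 \<le> den \<kappa> N \<theta> (z \<theta>)) \<and>
        (\<forall>\<theta>. \<forall>i<N. ((\<lambda>\<theta>. z \<theta> i) has_real_derivative
            profile_field \<kappa> N (\<omega> i - 1) \<theta> (z \<theta>) i) (at \<theta>))"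
    proof (intro exI conjI allI impI)
      show "\<bar>Z u \<theta> i\<bar> \<le> \<sigma>" for \<theta> i
        by (rule order_trans[OF Z_bnd[where u = u, OF adm_bnd[OF u]] \<open>s \<le> \<sigma>\<close>])
      show "Z u (\<theta> + 2 * pi) i = Z u \<theta> i" for \<theta> i
        using u by (simp add: Z_def h_per bounded_periodic_def)
      show "m / 2 \<le> den \<kappa> N \<theta> (Z u \<theta>)" for \<theta>
        by (rule den_ge[OF \<kappa> N Z_bnd[where u = u, OF adm_bnd[OF u]] s_den])
      show "((\<lambda>\<theta>. Z u \<theta> i) has_real_derivative profile_field \<kappa> N (\<omega> i - 1) \<theta> (Z u \<theta>) i) (at \<theta>)"
        if "i < N" for \<theta> i
        using Z_der[of i \<theta>] that by (simp add: w_def)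
    qed
  qed fact
qed

end

section \<open>Return to the time variable\<close>

lemma continuous_periodic_bounded:
  fixes f :: "real \<Rightarrow> real"
  assumes "continuous_on UNIV f" and "\<And>x. f (x + 2 * pi) = f x"
  obtains B where "\<And>x. \<bar>f x\<bar> \<le> B"
proof -
  interpret periodic_fun_simple f "2 * pi" by standard (fact assms(2))
  have "compact (f ` {0..2 * pi})"
    by (rule compact_continuous_image[OF continuous_on_subset[OF assms(1)]]) auto
  then have "bounded (f ` {0..2 * pi})" by (rule compact_imp_bounded)
  then obtain B where B: "\<And>x. x \<in> {0..2 * pi} \<Longrightarrow> \<bar>f x\<bar> \<le> B"
    unfolding bounded_iff real_norm_def by blast
  have "\<bar>f x\<bar> \<le> B" for x
  proof -
    let ?n = "\<lfloor>x / (2 * pi)\<rfloor>"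
    have "x - of_int ?n * (2 * pi) \<in> {0..2 * pi}"
      using floor_divide_lower[of "2 * pi" x] floor_divide_upper[of "2 * pi" x]
      by (simp add: distrib_right)
    from B[OF this] show ?thesis using minus_of_int[of x ?n] by simp
  qed
  then show ?thesis using that by blast
qed

lemma C2_periodic_data:
  assumes "C2_on UNIV f" and "periodic_fun_simple f (2 * pi)"
  obtains f' f'' and M :: real
  where "\<And>x. (f has_real_derivative f' x) (at x)" "\<And>x. (f' has_real_derivative f'' x) (at x)"
    "continuous_on UNIV f" "continuous_on UNIV f'" "continuous_on UNIV f''"
    "\<And>x. f (x + 2 * pi) = f x" "\<And>x. f' (x + 2 * pi) = f' x"
    "\<And>x. \<bar>f x\<bar> \<le> M" "\<And>x. \<bar>f' x\<bar> \<le> M" "\<And>x. \<bar>f'' x\<bar> \<le> M"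
proof -
  obtain f' f'' where d1: "\<And>x. (f has_real_derivative f' x) (at x)"
    and d2: "\<And>x. (f' has_real_derivative f'' x) (at x)" and c2: "continuous_on UNIV f''"
    using assms(1) by (auto simp: C2_on_def)
  have c0: "continuous_on UNIV f" and c1: "continuous_on UNIV f'"
    by (rule DERIV_continuous_on, rule has_field_derivative_at_within, rule d1 d2)+
  have per: "f (x + 2 * pi) = f x" for x by (rule periodic_fun_simple.plus_period[OF assms(2)])
  have shift: "F' (x + 2 * pi) = F' x"
    if "\<And>x. (F has_real_derivative F' x) (at x)" "\<And>x. F (x + 2 * pi) = F x" for F F' and x :: real
  proof (rule DERIV_unique)
    have "((\<lambda>x. F (x + 2 * pi)) has_real_derivative F' (x + 2 * pi)) (at x)"
      by (rule DERIV_shift[THEN iffD1, OF that(1)])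
    then show "(F has_real_derivative F' (x + 2 * pi)) (at x)" by (simp add: that(2))
  qed (rule that(1))
  have per': "f' (x + 2 * pi) = f' x" for x by (rule shift[OF d1 per])
  have per'': "f'' (x + 2 * pi) = f'' x" for x by (rule shift[OF d2 per'])
  obtain B0 where B0: "\<And>x. \<bar>f x\<bar> \<le> B0" by (rule continuous_periodic_bounded[OF c0 per]) blast
  obtain B1 where B1: "\<And>x. \<bar>f' x\<bar> \<le> B1" by (rule continuous_periodic_bounded[OF c1 per']) blast
  obtain B2 where B2: "\<And>x. \<bar>f'' x\<bar> \<le> B2" by (rule continuous_periodic_bounded[OF c2 per'']) blast
  show ?thesis
    by (rule that[OF d1 d2 c0 c1 c2 per per', of "max B0 (max B1 B2)"])
      (use B0 B1 B2 in \<open>auto simp: le_max_iff_disj\<close>)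
qed

text \<open>The velocity of an orbit is the field along the orbit, and the field is C^1 when P' and
  R' are continuous; the chain rule therefore yields a continuous second derivative.\<close>

lemma C2_on_winfree_orbit:
  assumes P: "\<And>x. (P has_real_derivative P' x) (at x)" and R: "\<And>x. (R has_real_derivative R' x) (at x)"
    and cont: "continuous_on UNIV P'" "continuous_on UNIV R'"
    and x: "\<And>t i. i < N \<Longrightarrow>
      ((\<lambda>s. x s i) has_real_derivative winfree_field N P R \<kappa> \<omega> (x t) i) (at t)"
    and i: "i < N"
  shows "C2_on S (\<lambda>t. x t i - \<Omega> * t)"
proof -
  let ?F = "\<lambda>t i. winfree_field N P R \<kappa> \<omega> (x t) i"
  let ?F' = "\<lambda>t. - (\<kappa> * (mean N (\<lambda>j. P' (x t j) * ?F t j) * R (x t i)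
      + R' (x t i) * ?F t i * mean N (\<lambda>j. P (x t j))))"
  have "((\<lambda>t. x t i - \<Omega> * t) has_real_derivative ?F t i - \<Omega>) (at t within S)" for t
    by (rule has_field_derivative_at_within) (auto intro!: derivative_eq_intros x i)
  moreover have "((\<lambda>t. ?F t i - \<Omega>) has_real_derivative ?F' t) (at t within S)" for t
  proof (rule has_field_derivative_at_within)
    have "((\<lambda>t. mean N (\<lambda>j. P (x t j))) has_real_derivative mean N (\<lambda>j. P' (x t j) * ?F t j)) (at t)"
      by (intro has_real_derivative_mean DERIV_chain2[OF P] x)
    from DERIV_mult[OF this DERIV_chain2[OF R x[OF i]]]
    have "((\<lambda>t. \<omega> i - \<kappa> * (mean N (\<lambda>j. P (x t j)) * R (x t i)) - \<Omega>) has_real_derivative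
        0 - \<kappa> * (mean N (\<lambda>j. P' (x t j) * ?F t j) * R (x t i)
        + R' (x t i) * ?F t i * mean N (\<lambda>j. P (x t j))) - 0) (at t)"
      by (intro DERIV_diff DERIV_cmult DERIV_const)
    then show "((\<lambda>t. ?F t i - \<Omega>) has_real_derivative ?F' t) (at t)"
      by (simp add: winfree_field_def)
  qed
  moreover have "continuous_on S ?F'"
  proof (rule continuous_on_subset[OF _ subset_UNIV])
    have xc: "continuous_on UNIV (\<lambda>t. x t j)" if "j < N" for j
      by (rule DERIV_continuous_on[OF has_field_derivative_at_within[OF x[OF that]]])
    have cP: "continuous_on UNIV P" and cR: "continuous_on UNIV R"
      by (rule DERIV_continuous_on, rule has_field_derivative_at_within, rule P R)+
    have c: "continuous_on UNIV (\<lambda>t. f (x t j))" if "continuous_on UNIV f" "j < N"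
      for f :: "real \<Rightarrow> real" and j
      by (rule continuous_on_compose2[OF that(1) xc[OF that(2)]]) simp
    show "continuous_on UNIV ?F'"
      unfolding winfree_field_def by (intro continuous_intros c cP cR cont i)
  qed
  ultimately show ?thesis unfolding C2_on_def
    by (intro exI[of _ "\<lambda>t. ?F t i - \<Omega>"] exI[of _ ?F']) blast
qed

text \<open>The drift is \<open>T\<close>-periodic, and on one period both \<open>th\<close> and the
  linear term lie in [0, 2 pi].\<close>

lemma bounded_drift_of_lift:
  fixes th :: "real \<Rightarrow> real"
  assumes "T > 0" and shift: "\<And>t. th (t + T) = th t + 2 * pi"
    and range: "\<And>t. 0 \<le> t \<Longrightarrow> t \<le> T \<Longrightarrow> 0 \<le> th t \<and> th t \<le> 2 * pi"
  shows "\<bar>th t - 2 * pi / T * t\<bar> \<le> 2 * pi"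
proof -
  define g where "g t = th t - 2 * pi / T * t" for t
  interpret periodic_fun_simple g T
    by standard (use \<open>T > 0\<close> in \<open>simp add: g_def shift field_simps\<close>)
  let ?s = "t - of_int \<lfloor>t / T\<rfloor> * T"
  have s: "0 \<le> ?s" "?s \<le> T"
    using floor_divide_lower[OF \<open>T > 0\<close>, of t] floor_divide_upper[OF \<open>T > 0\<close>, of t]
    by (simp_all add: distrib_right)
  have "2 * pi / T * ?s \<le> 2 * pi / T * T" using s \<open>T > 0\<close> by (intro mult_left_mono) auto
  then have "2 * pi / T * ?s \<le> 2 * pi" using \<open>T > 0\<close> by simp
  moreover have "0 \<le> 2 * pi / T * ?s" using s \<open>T > 0\<close> by simp
  ultimately have "\<bar>g ?s\<bar> \<le> 2 * pi" using range[OF s] unfolding g_def by linarith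
  then show ?thesis using minus_of_int[of t] by (simp add: g_def)
qed

text \<open>The autonomous equation th' = D(th) is solved by quadrature: \<open>tau\<close>, the
  integral of \<open>1 / D\<close>, is the time at which a phase is reached, \<open>th\<close> is
  its inverse, and the time of one turn, \<open>tau (2 * pi)\<close>, is the period
  \<open>T\<close>.\<close>

lemma phase_clock:
  fixes D :: "real \<Rightarrow> real"
  assumes cont: "continuous_on UNIV D" and per: "\<And>\<theta>. D (\<theta> + 2 * pi) = D \<theta>"
    and pos: "\<And>\<theta>. 0 < D \<theta>" and le: "\<And>\<theta>. D \<theta> \<le> E"
  obtains T and th :: "real \<Rightarrow> real" where "T > 0" "th 0 = 0"
    "\<And>t. (th has_real_derivative D (th t)) (at t)" "\<And>t. th (t + T) = th t + 2 * pi"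
    "\<And>t. 0 \<le> t \<Longrightarrow> t \<le> T \<Longrightarrow> 0 \<le> th t \<and> th t \<le> 2 * pi"
proof -
  have "E > 0" using pos[of 0] le[of 0] by linarith
  have "continuous_on UNIV (\<lambda>\<theta>. 1 / D \<theta>)"
    using pos by (intro continuous_intros cont) (metis less_irrefl)
  then obtain F where F: "\<And>\<theta>. (F has_real_derivative 1 / D \<theta>) (at \<theta>)"
    by (rule real_antiderivative_exists) blast
  define tau where "tau \<theta> = F \<theta> - F 0" for \<theta>
  have tau: "(tau has_real_derivative 1 / D \<theta>) (at \<theta>)" for \<theta>
    unfolding tau_def using DERIV_diff[OF F DERIV_const[of "F 0"]] by simp
  have tau_0: "tau 0 = 0" by (simp add: tau_def)
  have tau_per: "tau (\<theta> + 2 * pi) = tau \<theta> + tau (2 * pi)" for \<theta>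
    using periodic_differentiable_const_increment[OF tau, of "2 * pi" \<theta>] by (simp add: per tau_0)
  \<comment> \<open>The bound \<open>D \<le> E\<close> gives \<open>tau\<close> at least slope
    \<open>1 / E\<close>. This makes \<open>tau\<close> strictly increasing and onto, and its
    inverse Lipschitz, hence continuous.\<close>
  have rate: "(b - a) / E \<le> tau b - tau a" if "a \<le> b" for a b
  proof -
    have "tau a - a / E \<le> tau b - b / E"
    proof (rule DERIV_nonneg_imp_nondecreasing[OF that], intro exI conjI)
      fix \<theta>
      show "((\<lambda>\<theta>. tau \<theta> - \<theta> / E) has_real_derivative 1 / D \<theta> - 1 / E) (at \<theta>)"
        by (intro DERIV_diff tau DERIV_cdivide DERIV_ident)
      show "0 \<le> 1 / D \<theta> - 1 / E" using pos[of \<theta>] le[of \<theta>] by (simp add: frac_le)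
    qed
    then show ?thesis by (simp add: diff_divide_distrib)
  qed
  have tau_less: "tau a < tau b" if "a < b" for a b
    using rate[of a b] that \<open>E > 0\<close> divide_pos_pos[of "b - a" E] by linarith
  have "\<exists>\<theta>. tau \<theta> = t" for t
  proof -
    have "\<bar>t\<bar> \<le> tau (E * \<bar>t\<bar>)" using rate[of 0 "E * \<bar>t\<bar>"] \<open>E > 0\<close> by (simp add: tau_0)
    moreover have "tau (- (E * \<bar>t\<bar>)) \<le> - \<bar>t\<bar>" using rate[of "- (E * \<bar>t\<bar>)" 0] \<open>E > 0\<close> by (simp add: tau_0)
    moreover have "continuous_on {- (E * \<bar>t\<bar>)..E * \<bar>t\<bar>} tau"
      by (rule DERIV_continuous_on[OF has_field_derivative_at_within[OF tau]])
    moreover have "- (E * \<bar>t\<bar>) \<le> E * \<bar>t\<bar>" using \<open>E > 0\<close> by simp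
    ultimately have "\<exists>\<theta>\<ge>- (E * \<bar>t\<bar>). \<theta> \<le> E * \<bar>t\<bar> \<and> tau \<theta> = t"
      by (intro IVT') linarith+
    then show ?thesis by blast
  qed
  then obtain th where th: "\<And>t. tau (th t) = t" by metis
  have th_tau: "th (tau \<theta>) = \<theta>" for \<theta>
    using th[of "tau \<theta>"] tau_less by (metis linorder_less_linear less_irrefl)
  have th_mono: "th s \<le> th t" if "s \<le> t" for s t
    using tau_less[of "th t" "th s"] th that by (metis linorder_not_le)
  have th_lip: "\<bar>th s - th t\<bar> \<le> E * \<bar>s - t\<bar>" for s t
  proof -
    have *: "\<bar>th s - th t\<bar> \<le> E * \<bar>s - t\<bar>" if "s \<le> t" for s t
      using rate[OF th_mono[OF that]] th_mono[OF that] that \<open>E > 0\<close> by (simp add: th field_simps)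
    show ?thesis using *[of s t] *[of t s] by (cases "s \<le> t") (auto simp: abs_minus_commute)
  qed
  have "E-lipschitz_on UNIV th"
    using th_lip \<open>E > 0\<close> by (intro lipschitz_onI) (auto simp: dist_real_def)
  then have th_cont: "isCont th t" for t
    using lipschitz_on_continuous_on continuous_on_eq_continuous_at open_UNIV by blast
  show ?thesis
  proof
    show "tau (2 * pi) > 0" using tau_less[of 0 "2 * pi"] by (simp add: tau_0)
    show "th 0 = 0" using th_tau[of 0] by (simp add: tau_0)
    show "th (t + tau (2 * pi)) = th t + 2 * pi" for t
      using th_tau[of "th t + 2 * pi"] by (simp add: tau_per th)
    show "(th has_real_derivative D (th t)) (at t)" for t
      using DERIV_inverse_function[where f = tau and g = th and a = "t - 1" and b = "t + 1",
          OF tau _ _ _ th th_cont] pos[of "th t"] by simp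
    show "0 \<le> th t \<and> th t \<le> 2 * pi" if "0 \<le> t" "t \<le> tau (2 * pi)" for t
      using th_mono[OF that(1)] th_mono[OF that(2)] th_tau[of 0] th_tau[of "2 * pi"]
      by (simp add: tau_0)
  qed
qed

context winfree_reference
begin

text \<open>Running the profile along the clock with speed \<open>den\<close> gives
  \<open>th t + z (th t) i\<close>, whose velocity \<open>den\<close> plus
  \<open>profile_field\<close> times \<open>den\<close> is the Winfree field. The drift from uniform
  rotation is at most 2 pi from the clock plus \<open>\<sigma>\<close> from the profile, whatever
  \<open>N\<close> is.\<close>

lemma locked_orbit:
  assumes N: "N \<ge> 1" and z_bnd: "\<And>\<theta> i. \<bar>z \<theta> i\<bar> \<le> \<sigma>"
    and z_per: "\<And>\<theta> i. z (\<theta> + 2 * pi) i = z \<theta> i"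
    and den_pos: "\<And>\<theta>. m / 2 \<le> den \<kappa> N \<theta> (z \<theta>)"
    and z_der: "\<And>\<theta> i. i < N \<Longrightarrow>
      ((\<lambda>\<theta>. z \<theta> i) has_real_derivative profile_field \<kappa> N (\<omega> i - 1) \<theta> (z \<theta>) i) (at \<theta>)"
  obtains T and x :: "real \<Rightarrow> nat \<Rightarrow> real" where "T > 0"
    "\<And>t i. i < N \<Longrightarrow> ((\<lambda>s. x s i) has_real_derivative winfree_field N P R \<kappa> \<omega> (x t) i) (at t)"
    "\<And>t i. x (t + T) i = x t i + 2 * pi"
    "\<And>t i. \<bar>x t i - 2 * pi / T * t\<bar> \<le> 2 * pi + \<sigma>"
    "\<And>i. \<bar>x 0 i\<bar> \<le> \<sigma>"
proof -
  define D where "D \<theta> = den \<kappa> N \<theta> (z \<theta>)" for \<theta>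
  have D_pos: "0 < D \<theta>" for \<theta> using den_pos[of \<theta>] m_pos by (simp add: D_def)
  have zc: "continuous_on UNIV (\<lambda>\<theta>. z \<theta> i)" if "i < N" for i
    by (rule DERIV_continuous_on[OF has_field_derivative_at_within[OF z_der[OF that]]])
  have cP: "continuous_on UNIV P" and cR: "continuous_on UNIV R"
    by (rule DERIV_continuous_on, rule has_field_derivative_at_within, rule P_der R_der)+
  have "continuous_on UNIV (\<lambda>\<theta>. P (\<theta> + z \<theta> j))" if "j < N" for j
    by (rule continuous_on_compose2[OF cP]) (auto intro!: continuous_intros zc that)
  then have D_cont: "continuous_on UNIV D"
    unfolding D_def den_def by (intro continuous_intros cR)
  have D_per: "D (\<theta> + 2 * pi) = D \<theta>" for \<theta>
  proof -
    have "P (\<theta> + 2 * pi + a) = P (\<theta> + a)" for a using P_per[of "\<theta> + a"] by (simp add: ac_simps)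
    then show ?thesis by (simp add: D_def den_def z_per R_per)
  qed
  have D_le: "D \<theta> \<le> 1 + \<bar>\<kappa>\<bar> * (M * M)" for \<theta>
  proof -
    have "\<bar>\<kappa> * mean N (\<lambda>j. P (\<theta> + z \<theta> j)) * R \<theta>\<bar> \<le> \<bar>\<kappa>\<bar> * (M * M)"
      unfolding abs_mult mult.assoc
      by (intro mult_left_mono mult_mono abs_mean_le P_bnd R_bnd M_nonneg) auto
    then show ?thesis unfolding D_def den_def by linarith
  qed
  obtain T th where "T > 0" and th_0: "th 0 = 0"
    and th_der: "\<And>t. (th has_real_derivative D (th t)) (at t)"
    and th_T: "\<And>t. th (t + T) = th t + 2 * pi"
    and th_range: "\<And>t. 0 \<le> t \<Longrightarrow> t \<le> T \<Longrightarrow> 0 \<le> th t \<and> th t \<le> 2 * pi"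
    using phase_clock[OF D_cont D_per D_pos D_le] by metis
  define x where "x t i = th t + z (th t) i" for t i
  show ?thesis
  proof
    show "T > 0" by fact
    show "x (t + T) i = x t i + 2 * pi" for t i by (simp add: x_def th_T z_per)
    show "\<bar>x t i - 2 * pi / T * t\<bar> \<le> 2 * pi + \<sigma>" for t i
      using bounded_drift_of_lift[where th = th and T = T, OF \<open>T > 0\<close> th_T th_range, of t] z_bnd[of "th t" i]
      unfolding x_def by linarith
    show "\<bar>x 0 i\<bar> \<le> \<sigma>" for i using z_bnd[of 0 i] by (simp add: x_def th_0)
  next
    fix t i assume i: "i < N"
    let ?\<theta> = "th t"
    have "profile_field \<kappa> N (\<omega> i - 1) ?\<theta> (z ?\<theta>) i * D ?\<theta> =
        \<omega> i - 1 - \<kappa> * mean N (\<lambda>j. P (?\<theta> + z ?\<theta> j)) * (R (?\<theta> + z ?\<theta> i) - R ?\<theta>)"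
      using D_pos[of ?\<theta>] by (simp add: profile_field_def D_def)
    then have "D ?\<theta> + profile_field \<kappa> N (\<omega> i - 1) ?\<theta> (z ?\<theta>) i * D ?\<theta> =
        winfree_field N P R \<kappa> \<omega> (x t) i"
      by (simp add: D_def den_def winfree_field_def x_def algebra_simps)
    moreover have "((\<lambda>s. x s i) has_real_derivative
        D ?\<theta> + profile_field \<kappa> N (\<omega> i - 1) ?\<theta> (z ?\<theta>) i * D ?\<theta>) (at t)"
      unfolding x_def by (intro DERIV_add th_der DERIV_chain2[OF z_der[OF i]])
    ultimately show "((\<lambda>s. x s i) has_real_derivative winfree_field N P R \<kappa> \<omega> (x t) i) (at t)"
      by simp
  qed
qed

end

section \<open>The parameter set\<close>

text \<open>\<open>h\<close> is the exponential of an antiderivative of the linear growth rate with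
  its mean removed; having mean 0, the corrected rate has a periodic antiderivative. Compactness of
  a period bounds \<open>h\<close> and \<open>1 / h\<close>.\<close>

lemma reference_weight_exists:
  fixes P P' R R' R'' :: "real \<Rightarrow> real"
  assumes P: "\<And>x. (P has_real_derivative P' x) (at x)"
    and R: "\<And>x. (R has_real_derivative R' x) (at x)"
    and R': "\<And>x. (R' has_real_derivative R'' x) (at x)"
    and cont: "continuous_on UNIV P'" "continuous_on UNIV R''"
    and per: "\<And>x. P (x + 2 * pi) = P x" "\<And>x. R (x + 2 * pi) = R x" "\<And>x. R' (x + 2 * pi) = R' x"
    and "0 < \<kappa>" and pos: "\<And>x. 0 < 1 - \<kappa> * P x * R x"
    and int: "0 < integral {0..2 * pi} (\<lambda>s. P s * R' s / (1 - \<kappa> * P s * R s))"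
  obtains h c H where "0 < c"
    "\<And>x. (h has_real_derivative (c - \<kappa> * P x * R' x / (1 - \<kappa> * P x * R x)) * h x) (at x)"
    "\<And>x. h (x + 2 * pi) = h x" "1 \<le> H" "\<And>x. h x \<le> H" "\<And>x. 1 / H \<le> h x" "C2_on UNIV h"
proof -
  have cts: "continuous_on UNIV P" "continuous_on UNIV R" "continuous_on UNIV R'"
    by (rule DERIV_continuous_on, rule has_field_derivative_at_within, rule P R R')+
  define f where "f x = P x * R' x / (1 - \<kappa> * P x * R x)" for x
  have nz: "1 - \<kappa> * P x * R x \<noteq> 0" for x using pos[of x] by simp
  have f_cont: "continuous_on UNIV f"
    unfolding f_def by (intro continuous_intros cts ballI nz)
  define J where "J = integral {0..2 * pi} f"
  have "J > 0" using int by (simp add: J_def f_def[abs_def])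
  \<comment> \<open>The mean of \<open>\<kappa> * f\<close> over a period; it is positive exactly by
    the integral hypothesis.\<close>
  define c where "c = \<kappa> * J / (2 * pi)"
  have "c > 0" using \<open>J > 0\<close> \<open>0 < \<kappa>\<close> by (simp add: c_def)
  define g where "g x = c - \<kappa> * f x" for x
  have g_cont: "continuous_on UNIV g" unfolding g_def by (intro continuous_intros f_cont)
  obtain G where G: "\<And>x. (G has_real_derivative g x) (at x)"
    by (rule real_antiderivative_exists[OF g_cont]) blast
  have "(g has_integral G (2 * pi) - G 0) {0..2 * pi}"
    by (rule fundamental_theorem_of_calculus)
      (auto intro!: has_field_derivative_at_within G simp flip: has_real_derivative_iff_has_vector_derivative)
  moreover have "(g has_integral (2 * pi) * c - \<kappa> * J) {0..2 * pi}"
  proof -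
    have "(f has_integral J) {0..2 * pi}"
      unfolding J_def
      by (intro integrable_integral integrable_continuous_real continuous_on_subset[OF f_cont]) auto
    from has_integral_diff[OF has_integral_const_real[of c 0 "2 * pi"] has_integral_mult_right[OF this, of \<kappa>]]
    show ?thesis by (simp add: g_def[abs_def])
  qed
  ultimately have "G (2 * pi) - G 0 = (2 * pi) * c - \<kappa> * J" by (rule has_integral_unique)
  then have G_2pi: "G (2 * pi) - G 0 = 0" by (simp add: c_def)
  have "G (x + 2 * pi) - G x = G (2 * pi) - G 0" for x
    by (rule periodic_differentiable_const_increment[OF G]) (simp add: g_def f_def per)
  then have G_per: "G (x + 2 * pi) = G x" for x using G_2pi by simp
  define h where "h x = exp (G x)" for x
  have h_der: "(h has_real_derivative g x * h x) (at x)" for x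
    unfolding h_def by (auto intro!: derivative_eq_intros G)
  have h_per: "h (x + 2 * pi) = h x" for x by (simp add: h_def G_per)
  have h_cont: "continuous_on UNIV h"
    by (rule DERIV_continuous_on[OF has_field_derivative_at_within[OF h_der]])
  obtain B1 where B1: "\<And>x. \<bar>h x\<bar> \<le> B1"
    by (rule continuous_periodic_bounded[OF h_cont h_per]) blast
  have "continuous_on UNIV (\<lambda>x. 1 / h x)"
    by (intro continuous_intros h_cont) (simp add: h_def)
  from continuous_periodic_bounded[OF this]
  obtain B2 where B2: "\<And>x. \<bar>1 / h x\<bar> \<le> B2" by (metis h_per)
  define H where "H = max 1 (max B1 B2)"
  show ?thesis
  proof
    show "0 < c" by fact
    show "(h has_real_derivative (c - \<kappa> * P x * R' x / (1 - \<kappa> * P x * R x)) * h x) (at x)" for x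
      using h_der[of x] by (simp add: g_def f_def mult.assoc)
    show "h (x + 2 * pi) = h x" for x by fact
    show "1 \<le> H" by (simp add: H_def)
    show "h x \<le> H" for x using B1[of x] unfolding H_def by linarith
    show "1 / H \<le> h x" for x
    proof -
      have "h x > 0" by (simp add: h_def)
      have "1 / h x \<le> H" using B2[of x] unfolding H_def by linarith
      then show ?thesis using \<open>h x > 0\<close> \<open>1 \<le> H\<close> by (simp add: field_simps)
    qed
    \<comment> \<open>The derivative of the growth integrand by the quotient rule. A second
      continuous derivative of \<open>h\<close> requires it to be continuous, which rests on the
      continuity of P' and R''.\<close>
    define f' where "f' x = ((P' x * R' x + R'' x * P x) * (1 - \<kappa> * P x * R x)
      - (P x * R' x) * (0 - (\<kappa> * P' x * R x + R' x * (\<kappa> * P x))))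
      / ((1 - \<kappa> * P x * R x) * (1 - \<kappa> * P x * R x))" for x
    have "(f has_real_derivative f' x) (at x)" for x
      unfolding f_def f'_def
      by (intro DERIV_divide DERIV_mult DERIV_diff DERIV_const DERIV_cmult P R R' nz)
    then have g_der: "(g has_real_derivative 0 - \<kappa> * f' x) (at x)" for x
      unfolding g_def by (intro DERIV_diff DERIV_const DERIV_cmult)
    have "((\<lambda>x. g x * h x) has_real_derivative (0 - \<kappa> * f' x) * h x + g x * h x * g x) (at x)" for x
      by (rule DERIV_mult[OF g_der h_der])
    moreover have "continuous_on UNIV f'"
      unfolding f'_def using nz by (intro continuous_intros cts cont) auto
    then have "continuous_on UNIV (\<lambda>x. (0 - \<kappa> * f' x) * h x + g x * h x * g x)"
      by (intro continuous_intros g_cont h_cont)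
    ultimately show "C2_on UNIV h"
      unfolding C2_on_def using h_der
      by (intro exI[of _ "\<lambda>x. g x * h x"] exI[of _ "\<lambda>x. (0 - \<kappa> * f' x) * h x + g x * h x * g x"]) simp
  qed
qed

lemma C2_on_cmult:
  assumes "C2_on S f" shows "C2_on S (\<lambda>x. a * f x)"
proof -
  obtain f' f'' where "\<forall>x\<in>S. (f has_real_derivative f' x) (at x within S)"
    "\<forall>x\<in>S. (f' has_real_derivative f'' x) (at x within S)" "continuous_on S f''"
    using assms unfolding C2_on_def by blast
  then show ?thesis
    unfolding C2_on_def
    by (intro exI[of _ "\<lambda>x. a * f' x"] exI[of _ "\<lambda>x. a * f'' x"])
      (auto intro!: DERIV_cmult continuous_intros)
qed

text \<open>What has to be shown at one parameter pair. \<open>\<Delta>\<close> and \<open>B\<close>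
  are quantified before \<open>N\<close> and \<open>\<omega>\<close>, which encodes their
  independence of the number of oscillators and of the frequencies.\<close>

definition locks_near_diagonal ::
  "(real \<Rightarrow> real) \<Rightarrow> (real \<Rightarrow> real) \<Rightarrow> real \<Rightarrow> real \<Rightarrow> bool" where
  "locks_near_diagonal P R \<gamma> \<kappa> \<longleftrightarrow> (\<exists>(\<Delta> :: real \<Rightarrow> real) (B :: real).
      C2_on UNIV \<Delta> \<and> periodic_fun_simple \<Delta> (2 * pi) \<and> (\<forall>s. 0 < \<Delta> s \<and> \<Delta> s < 1) \<and>
      (\<forall>(N :: nat) (\<omega> :: nat \<Rightarrow> real).
        N \<ge> 1 \<longrightarrow> (\<forall>i<N. 1 - \<gamma> < \<omega> i \<and> \<omega> i < 1 + \<gamma>) \<longrightarrow>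
        (openin (Euclidean_space N) (sync_tube N \<Delta>) \<and>
         (\<forall>X \<in> sync_tube N \<Delta>. \<exists>x. winfree_solution N P R \<kappa> \<omega> x \<and> x 0 = X) \<and>
         (\<forall>x. winfree_solution N P R \<kappa> \<omega> x \<longrightarrow> x 0 \<in> sync_tube N \<Delta> \<longrightarrow>
            (\<forall>t\<ge>0. x t \<in> sync_tube N \<Delta>) \<and> synchronized N x)) \<and>
        (\<exists>X \<in> sync_tube N \<Delta>. \<exists>\<Omega> > 0. \<exists>\<Psi> :: nat \<Rightarrow> real \<Rightarrow> real.
           (\<forall>i<N. C2_on {0..} (\<Psi> i)) \<and>
           (\<forall>i<N. \<forall>t\<ge>0. \<Psi> i (t + 2 * pi / \<Omega>) = \<Psi> i t) \<and>
           (\<forall>i<N. \<forall>t\<ge>0. \<bar>\<Psi> i t\<bar> \<le> B) \<and>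
           (\<forall>x. winfree_solution N P R \<kappa> \<omega> x \<longrightarrow> x 0 = X \<longrightarrow>
              (\<forall>i<N. \<forall>t\<ge>0. x t i = \<Omega> * t + \<Psi> i t) \<and> periodically_locked N \<Omega> x))))"

context winfree_reference
begin

text \<open>Combines the inward tube with the locked orbit. The profile can be made as small as
  desired, so it is taken small against the least width of the tube, and the orbit starts
  inside.\<close>

lemma locks_near_reference:
  assumes C2_h: "C2_on UNIV h" and cont': "continuous_on UNIV P'" "continuous_on UNIV R'"
  obtains r where "0 < r"
    "\<And>\<gamma> \<kappa>. 0 \<le> \<kappa> \<Longrightarrow> \<gamma> < r \<Longrightarrow> \<bar>\<kappa> - \<kappa>0\<bar> < r \<Longrightarrow> locks_near_diagonal P R \<gamma> \<kappa>"
proof -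
  obtain \<epsilon> r1 where "0 < \<epsilon>" "0 < r1" and \<epsilon>_small: "\<And>s. \<epsilon> * h s < 1"
    and inward: "\<And>\<gamma> \<kappa> N \<omega> X i j. \<gamma> < r1 \<Longrightarrow> \<bar>\<kappa> - \<kappa>0\<bar> < r1 \<Longrightarrow>
      (\<And>k. k < N \<Longrightarrow> \<bar>\<omega> k - 1\<bar> \<le> \<gamma>) \<Longrightarrow> i < N \<Longrightarrow> j < N \<Longrightarrow>
      (\<And>k l. k < N \<Longrightarrow> l < N \<Longrightarrow> \<bar>X k - X l\<bar> \<le> \<epsilon> * h (mean N X)) \<Longrightarrow> X j - X i = \<epsilon> * h (mean N X) \<Longrightarrow>
      winfree_field N P R \<kappa> \<omega> X j - winfree_field N P R \<kappa> \<omega> X i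
        < \<epsilon> * (growth (mean N X) * h (mean N X)) * mean N (winfree_field N P R \<kappa> \<omega> X)"
    by (rule tube_is_inward) blast
  \<comment> \<open>The factor 3 gives \<open>2 * \<sigma> < \<epsilon> / H\<close>: two initial
    phases, each within \<open>\<sigma>\<close> of 0, differ by less than the least tube
    width.\<close>
  define \<sigma> where "\<sigma> = min 1 (\<epsilon> / (3 * H))"
  have H: "H > 0" using H_ge by simp
  have "\<sigma> > 0" using \<open>0 < \<epsilon>\<close> H by (simp add: \<sigma>_def)
  obtain r2 where "0 < r2" and profile: "\<And>\<gamma> \<kappa> N \<omega>. \<gamma> < r2 \<Longrightarrow> \<bar>\<kappa> - \<kappa>0\<bar> < r2 \<Longrightarrow> N \<ge> 1 \<Longrightarrow>
      (\<And>i. i < N \<Longrightarrow> \<bar>\<omega> i - 1\<bar> \<le> \<gamma>) \<Longrightarrow>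
      \<exists>z. (\<forall>\<theta> i. \<bar>z \<theta> i\<bar> \<le> \<sigma>) \<and> (\<forall>\<theta> i. z (\<theta> + 2 * pi) i = z \<theta> i) \<and>
        (\<forall>\<theta>. m / 2 \<le> den \<kappa> N \<theta> (z \<theta>)) \<and>
        (\<forall>\<theta>. \<forall>i<N. ((\<lambda>\<theta>. z \<theta> i) has_real_derivative
            profile_field \<kappa> N (\<omega> i - 1) \<theta> (z \<theta>) i) (at \<theta>))"
    by (rule profile_exists[OF \<open>\<sigma> > 0\<close>]) blast
  define \<Delta> where "\<Delta> s = \<epsilon> * h s" for s
  have \<Delta>_der: "(\<Delta> has_real_derivative \<epsilon> * (growth s * h s)) (at s)" for s
    unfolding \<Delta>_def growth_def by (rule DERIV_cmult[OF h_der])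
  have \<Delta>_cont: "continuous_on UNIV \<Delta>"
    by (rule DERIV_continuous_on[OF has_field_derivative_at_within[OF \<Delta>_der]])
  have cP: "continuous_on UNIV P" and cR: "continuous_on UNIV R"
    by (rule DERIV_continuous_on, rule has_field_derivative_at_within, rule P_der R_der)+
  show ?thesis
  proof
    show "0 < min r1 r2" using \<open>0 < r1\<close> \<open>0 < r2\<close> by simp
  next
    fix \<gamma> \<kappa> :: real
    assume "0 \<le> \<kappa>" and \<gamma>: "\<gamma> < min r1 r2" and \<kappa>: "\<bar>\<kappa> - \<kappa>0\<bar> < min r1 r2"
    have main: "(openin (Euclidean_space N) (sync_tube N \<Delta>) \<and>
         (\<forall>X \<in> sync_tube N \<Delta>. \<exists>x. winfree_solution N P R \<kappa> \<omega> x \<and> x 0 = X) \<and>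
         (\<forall>x. winfree_solution N P R \<kappa> \<omega> x \<longrightarrow> x 0 \<in> sync_tube N \<Delta> \<longrightarrow>
            (\<forall>t\<ge>0. x t \<in> sync_tube N \<Delta>) \<and> synchronized N x)) \<and>
        (\<exists>X \<in> sync_tube N \<Delta>. \<exists>\<Omega> > 0. \<exists>\<Psi> :: nat \<Rightarrow> real \<Rightarrow> real.
           (\<forall>i<N. C2_on {0..} (\<Psi> i)) \<and>
           (\<forall>i<N. \<forall>t\<ge>0. \<Psi> i (t + 2 * pi / \<Omega>) = \<Psi> i t) \<and>
           (\<forall>i<N. \<forall>t\<ge>0. \<bar>\<Psi> i t\<bar> \<le> 2 * pi + \<sigma>) \<and>
           (\<forall>x. winfree_solution N P R \<kappa> \<omega> x \<longrightarrow> x 0 = X \<longrightarrow>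
              (\<forall>i<N. \<forall>t\<ge>0. x t i = \<Omega> * t + \<Psi> i t) \<and> periodically_locked N \<Omega> x))"
      if N: "N \<ge> 1" and \<omega>': "\<forall>i<N. 1 - \<gamma> < \<omega> i \<and> \<omega> i < 1 + \<gamma>" for N \<omega>
    proof -
      have \<omega>: "\<bar>\<omega> i - 1\<bar> \<le> \<gamma>" if "i < N" for i using \<omega>'[rule_format, OF that] by linarith
      note exist = winfree_solution_exists[OF P_bnd R_bnd P_lip R_lip cP cR \<open>0 \<le> \<kappa>\<close>]
      note unique = winfree_solution_unique[OF P_bnd R_bnd P_lip R_lip \<open>0 \<le> \<kappa>\<close>]
      have inv: "x t \<in> sync_tube N \<Delta>"
        if "winfree_solution N P R \<kappa> \<omega> x" "x 0 \<in> sync_tube N \<Delta>" "0 \<le> t" for x t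
      proof (rule sync_tube_invariant[OF N \<Delta>_der _ that])
        fix X i j
        assume ij: "i < N" "j < N" and le: "\<And>k l. k < N \<Longrightarrow> l < N \<Longrightarrow> \<bar>X k - X l\<bar> \<le> \<Delta> (mean N X)"
          and eq: "X j - X i = \<Delta> (mean N X)"
        show "winfree_field N P R \<kappa> \<omega> X j - winfree_field N P R \<kappa> \<omega> X i
          < \<epsilon> * (growth (mean N X) * h (mean N X)) * mean N (winfree_field N P R \<kappa> \<omega> X)"
          by (rule inward[OF _ _ \<omega> ij le[unfolded \<Delta>_def] eq[unfolded \<Delta>_def]]) (use \<gamma> \<kappa> in auto)
      qed
      have sync: "synchronized N x"
        if "winfree_solution N P R \<kappa> \<omega> x" "x 0 \<in> sync_tube N \<Delta>" for x
      proof -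
        have "spread N (x t) \<le> 1" if "0 \<le> t" for t
          using inv[OF \<open>winfree_solution N P R \<kappa> \<omega> x\<close> \<open>x 0 \<in> sync_tube N \<Delta>\<close> that]
            \<epsilon>_small[of "mean N (x t)"] by (simp add: sync_tube_def \<Delta>_def)
        then show ?thesis by (auto simp: synchronized_def intro!: bdd_aboveI2)
      qed
      have \<gamma>2: "\<gamma> < r2" and \<kappa>2: "\<bar>\<kappa> - \<kappa>0\<bar> < r2" using \<gamma> \<kappa> by auto
      from profile[where \<omega> = \<omega>, OF \<gamma>2 \<kappa>2 N \<omega>] obtain z where z: "\<And>\<theta> i. \<bar>z \<theta> i\<bar> \<le> \<sigma>"
        "\<And>\<theta> i. z (\<theta> + 2 * pi) i = z \<theta> i" "\<And>\<theta>. m / 2 \<le> den \<kappa> N \<theta> (z \<theta>)"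
        "\<And>\<theta> i. i < N \<Longrightarrow> ((\<lambda>\<theta>. z \<theta> i) has_real_derivative
            profile_field \<kappa> N (\<omega> i - 1) \<theta> (z \<theta>) i) (at \<theta>)"
        by blast
      obtain T and x :: "real \<Rightarrow> nat \<Rightarrow> real" where "T > 0"
        and x_der: "\<And>t i. i < N \<Longrightarrow>
          ((\<lambda>s. x s i) has_real_derivative winfree_field N P R \<kappa> \<omega> (x t) i) (at t)"
        and x_T: "\<And>t i. x (t + T) i = x t i + 2 * pi"
        and x_drift: "\<And>t i. \<bar>x t i - 2 * pi / T * t\<bar> \<le> 2 * pi + \<sigma>"
        and x_0: "\<And>i. \<bar>x 0 i\<bar> \<le> \<sigma>"
        by (rule locked_orbit[OF N z]) blast+
      \<comment> \<open>Coordinates beyond \<open>N\<close> are set to 0 so that the orbit takes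
        values in \<open>Euclidean_space N\<close>.\<close>
      define y where "y t i = (if i < N then x t i else 0)" for t i
      define \<Omega> where "\<Omega> = 2 * pi / T"
      have "\<Omega> > 0" and T: "2 * pi / \<Omega> = T" using \<open>T > 0\<close> by (auto simp: \<Omega>_def)
      define \<Psi> where "\<Psi> i t = x t i - \<Omega> * t" for i t
      have y_sol: "winfree_solution N P R \<kappa> \<omega> y"
        unfolding winfree_solution_iff
      proof (intro conjI allI impI)
        fix t :: real and i assume "i < N"
        have "winfree_field N P R \<kappa> \<omega> (y t) i = winfree_field N P R \<kappa> \<omega> (x t) i"
          by (rule winfree_field_cong[OF \<open>i < N\<close>]) (simp add: y_def)
        then show "((\<lambda>s. y s i) has_real_derivative winfree_field N P R \<kappa> \<omega> (y t) i) (at t within {0..})"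
          using has_field_derivative_at_within[OF x_der[OF \<open>i < N\<close>]] \<open>i < N\<close> by (simp add: y_def)
      qed (simp add: y_def)
      have y_in: "y 0 \<in> sync_tube N \<Delta>"
        unfolding sync_tube_iff[OF N]
      proof (intro conjI allI impI)
        fix i j assume "i < N" "j < N"
        have "\<sigma> \<le> \<epsilon> / (3 * H)" by (simp add: \<sigma>_def)
        then have "2 * \<sigma> < \<epsilon> * (1 / H)" using \<open>0 < \<epsilon>\<close> H by (simp add: field_simps)
        also have "\<dots> \<le> \<Delta> (mean N (y 0))"
          unfolding \<Delta>_def using h_ge \<open>0 < \<epsilon>\<close> by (intro mult_left_mono) auto
        finally show "y 0 j - y 0 i < \<Delta> (mean N (y 0))"
          using x_0[of i] x_0[of j] \<open>i < N\<close> \<open>j < N\<close> by (simp add: y_def)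
      qed (simp add: y_def)
      have \<Psi>_per: "\<Psi> i (t + T) = \<Psi> i t" for i t
      proof -
        have "\<Omega> * (t + T) = \<Omega> * t + 2 * pi" using \<open>T > 0\<close> by (simp add: \<Omega>_def field_simps)
        then show ?thesis by (simp add: \<Psi>_def x_T)
      qed
      \<comment> \<open>Uniqueness identifies every solution starting at \<open>y 0\<close> with the
        constructed orbit.\<close>
      have locked: "(\<forall>i<N. \<forall>t\<ge>0. x' t i = \<Omega> * t + \<Psi> i t) \<and> periodically_locked N \<Omega> x'"
        if x': "winfree_solution N P R \<kappa> \<omega> x'" "x' 0 = y 0" for x'
      proof
        show eq: "\<forall>i<N. \<forall>t\<ge>0. x' t i = \<Omega> * t + \<Psi> i t"
          using unique[OF x'(1) y_sol x'(2)] by (simp add: y_def \<Psi>_def)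
        show "periodically_locked N \<Omega> x'"
          unfolding periodically_locked_def
        proof (intro conjI exI[of _ \<Psi>] eq)
          show "\<Omega> \<noteq> 0" using \<open>\<Omega> > 0\<close> by simp
          show "synchronized N x'" by (rule sync) (use x' y_in in auto)
          show "\<forall>i<N. periodic_fun_simple (\<Psi> i) (2 * pi / \<Omega>)"
            unfolding T by (auto intro!: periodic_fun_simple.intro \<Psi>_per)
        qed
      qed
      have "C2_on {0..} (\<Psi> i)" if "i < N" for i
        unfolding \<Psi>_def by (rule C2_on_winfree_orbit[OF P_der R_der cont' x_der that])
      moreover have "\<bar>\<Psi> i t\<bar> \<le> 2 * pi + \<sigma>" for i t
        using x_drift by (simp add: \<Psi>_def \<Omega>_def)
      ultimately have orbit: "\<exists>X \<in> sync_tube N \<Delta>. \<exists>\<Omega> > 0. \<exists>\<Psi> :: nat \<Rightarrow> real \<Rightarrow> real.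
           (\<forall>i<N. C2_on {0..} (\<Psi> i)) \<and>
           (\<forall>i<N. \<forall>t\<ge>0. \<Psi> i (t + 2 * pi / \<Omega>) = \<Psi> i t) \<and>
           (\<forall>i<N. \<forall>t\<ge>0. \<bar>\<Psi> i t\<bar> \<le> 2 * pi + \<sigma>) \<and>
           (\<forall>x. winfree_solution N P R \<kappa> \<omega> x \<longrightarrow> x 0 = X \<longrightarrow>
              (\<forall>i<N. \<forall>t\<ge>0. x t i = \<Omega> * t + \<Psi> i t) \<and> periodically_locked N \<Omega> x)"
        using y_in \<open>\<Omega> > 0\<close> \<Psi>_per locked
        by (intro bexI[of _ "y 0"] exI[of _ \<Omega>] exI[of _ \<Psi>] conjI) (auto simp: T)
      show ?thesis
      proof (intro conjI orbit)
        show "openin (Euclidean_space N) (sync_tube N \<Delta>)"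
          by (rule openin_sync_tube[OF N \<Delta>_cont])
        show "\<forall>X \<in> sync_tube N \<Delta>. \<exists>x. winfree_solution N P R \<kappa> \<omega> x \<and> x 0 = X"
          by (intro ballI exist) (simp add: sync_tube_def)
        show "\<forall>x. winfree_solution N P R \<kappa> \<omega> x \<longrightarrow> x 0 \<in> sync_tube N \<Delta> \<longrightarrow>
            (\<forall>t\<ge>0. x t \<in> sync_tube N \<Delta>) \<and> synchronized N x"
          using inv sync by blast
      qed
    qed
    show "locks_near_diagonal P R \<gamma> \<kappa>"
      unfolding locks_near_diagonal_def
    proof (intro exI[of _ \<Delta>] exI[of _ "2 * pi + \<sigma>"] conjI)
      show "C2_on UNIV \<Delta>" unfolding \<Delta>_def by (rule C2_on_cmult[OF C2_h])
      show "periodic_fun_simple \<Delta> (2 * pi)"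
        by (rule periodic_fun_simple.intro) (simp add: \<Delta>_def h_per)
      show "\<forall>s. 0 < \<Delta> s \<and> \<Delta> s < 1"
        using \<open>0 < \<epsilon>\<close> h_pos \<epsilon>_small by (simp add: \<Delta>_def)
    qed (intro allI impI, rule main; assumption)
  qed
qed

end

section \<open>The critical coupling\<close>

lemma kappa_star_ge: "0 < \<kappa> \<Longrightarrow> (\<And>x. 0 < 1 - \<kappa> * P x * R x) \<Longrightarrow> ereal \<kappa> \<le> kappa_star P R"
  unfolding kappa_star_def by (intro Sup_upper) auto

text \<open>An admissible coupling \<open>\<kappa>2\<close> above \<open>\<kappa>\<close> gives P R
  < 1 / \<kappa>2 everywhere, hence the uniform lower bound \<open>1 - \<kappa> / \<kappa>2\<close>
  on the synchronised speed. It also leaves room to increase \<open>\<kappa>\<close>.\<close>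

lemma less_kappa_starE:
  assumes "ereal \<kappa> < kappa_star P R" and "0 < \<kappa>"
  obtains \<kappa>2 where "\<kappa> < \<kappa>2" "ereal \<kappa>2 \<le> kappa_star P R" "\<And>x. 1 - \<kappa> / \<kappa>2 \<le> 1 - \<kappa> * P x * R x"
proof -
  from assms(1) obtain \<kappa>2 where k: "\<kappa> < \<kappa>2" "0 < \<kappa>2" "\<And>x. 0 < 1 - \<kappa>2 * P x * R x"
    unfolding kappa_star_def less_Sup_iff by auto
  show ?thesis
  proof (rule that[OF k(1) kappa_star_ge[OF k(2,3)]])
    fix x
    have "\<kappa> * (\<kappa>2 * P x * R x) \<le> \<kappa> * 1"
      using k(3)[of x] assms(2) by (intro mult_left_mono) auto
    then show "1 - \<kappa> / \<kappa>2 \<le> 1 - \<kappa> * P x * R x"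
      using k(2) by (simp add: field_simps)
  qed
qed

text \<open>Boundedness of P R makes 1 / (M^2 + 1) admissible, and halving it gives strict
  inequality. The resulting interior coupling is needed to approach the end points of
  [0, \<kappa>*].\<close>

lemma kappa_star_pos:
  assumes "\<And>x. \<bar>P x\<bar> \<le> M" "\<And>x. \<bar>R x\<bar> \<le> M"
  obtains \<kappa> where "0 < \<kappa>" "ereal \<kappa> < kappa_star P R"
proof -
  have "0 \<le> M" using assms(1)[of 0] by linarith
  define \<kappa> where "\<kappa> = 1 / (M * M + 1)"
  have "M * M + 1 > 0" using \<open>0 \<le> M\<close> by (simp add: add_nonneg_pos)
  then have "\<kappa> > 0" by (simp add: \<kappa>_def)
  have "0 < 1 - \<kappa> * P x * R x" for x
  proof -
    have "P x * R x \<le> M * M"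
      using abs_le_D1[of "P x * R x" "M * M"] mult_mono[OF assms(1) assms(2), of x x] \<open>0 \<le> M\<close>
      by (simp add: abs_mult)
    then have "\<kappa> * (P x * R x) \<le> \<kappa> * (M * M)" using \<open>\<kappa> > 0\<close> by simp
    also have "\<dots> < 1" using \<open>M * M + 1 > 0\<close> by (simp add: \<kappa>_def)
    finally show ?thesis by (simp add: mult.assoc)
  qed
  from kappa_star_ge[OF \<open>\<kappa> > 0\<close> this] have "ereal \<kappa> \<le> kappa_star P R" .
  then have "ereal (\<kappa> / 2) < kappa_star P R"
    using \<open>\<kappa> > 0\<close> less_le_trans[of "ereal (\<kappa> / 2)" "ereal \<kappa>"] by simp
  then show ?thesis using that[of "\<kappa> / 2"] \<open>\<kappa> > 0\<close> by simp
qed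

theorem theorem3:
  fixes P R :: "real \<Rightarrow> real"
  assumes "C2_on UNIV P" and "C2_on UNIV R"
    and "periodic_fun_simple P (2 * pi)" and "periodic_fun_simple R (2 * pi)"
    and "\<And>\<kappa>. 0 < \<kappa> \<Longrightarrow> ereal \<kappa> < kappa_star P R \<Longrightarrow>
           integral {0..2 * pi} (\<lambda>s. P s * deriv R s / (1 - \<kappa> * P s * R s)) > 0"
  shows "\<exists>U :: (real \<times> real) set.
    open U \<and>
    U \<subseteq> {(\<gamma>, \<kappa>). 0 < \<gamma> \<and> \<gamma> < 1 \<and> 0 < \<kappa> \<and> ereal \<kappa> < kappa_star P R} \<and>
    {(\<gamma>, \<kappa>). \<gamma> = 0 \<and> 0 \<le> \<kappa> \<and> ereal \<kappa> \<le> kappa_star P R} \<subseteq> closure U \<and>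
    (\<forall>(\<gamma>, \<kappa>) \<in> U. \<exists>(\<Delta> :: real \<Rightarrow> real) (B :: real).
      C2_on UNIV \<Delta> \<and> periodic_fun_simple \<Delta> (2 * pi) \<and> (\<forall>s. 0 < \<Delta> s \<and> \<Delta> s < 1) \<and>
      (\<forall>(N :: nat) (\<omega> :: nat \<Rightarrow> real).
        N \<ge> 1 \<longrightarrow> (\<forall>i<N. 1 - \<gamma> < \<omega> i \<and> \<omega> i < 1 + \<gamma>) \<longrightarrow>
        (openin (Euclidean_space N) (sync_tube N \<Delta>) \<and>
         (\<forall>X \<in> sync_tube N \<Delta>. \<exists>x. winfree_solution N P R \<kappa> \<omega> x \<and> x 0 = X) \<and>
         (\<forall>x. winfree_solution N P R \<kappa> \<omega> x \<longrightarrow> x 0 \<in> sync_tube N \<Delta> \<longrightarrow>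
            (\<forall>t\<ge>0. x t \<in> sync_tube N \<Delta>) \<and> synchronized N x)) \<and>
        (\<exists>X \<in> sync_tube N \<Delta>. \<exists>\<Omega> > 0. \<exists>\<Psi> :: nat \<Rightarrow> real \<Rightarrow> real.
           (\<forall>i<N. C2_on {0..} (\<Psi> i)) \<and>
           (\<forall>i<N. \<forall>t\<ge>0. \<Psi> i (t + 2 * pi / \<Omega>) = \<Psi> i t) \<and>
           (\<forall>i<N. \<forall>t\<ge>0. \<bar>\<Psi> i t\<bar> \<le> B) \<and>
           (\<forall>x. winfree_solution N P R \<kappa> \<omega> x \<longrightarrow> x 0 = X \<longrightarrow>
              (\<forall>i<N. \<forall>t\<ge>0. x t i = \<Omega> * t + \<Psi> i t) \<and> periodically_locked N \<Omega> x))))"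
proof -
  let ?K = "{\<kappa>. 0 < \<kappa> \<and> ereal \<kappa> < kappa_star P R}"
  obtain P' P'' MP where P: "\<And>x. (P has_real_derivative P' x) (at x)"
    "\<And>x. (P' has_real_derivative P'' x) (at x)"
    "continuous_on UNIV P" "continuous_on UNIV P'" "continuous_on UNIV P''"
    "\<And>x. P (x + 2 * pi) = P x" "\<And>x. P' (x + 2 * pi) = P' x"
    "\<And>x. \<bar>P x\<bar> \<le> MP" "\<And>x. \<bar>P' x\<bar> \<le> MP" "\<And>x. \<bar>P'' x\<bar> \<le> MP"
    by (rule C2_periodic_data[OF assms(1,3)]) blast
  obtain R' R'' MR where R: "\<And>x. (R has_real_derivative R' x) (at x)"
    "\<And>x. (R' has_real_derivative R'' x) (at x)"
    "continuous_on UNIV R" "continuous_on UNIV R'" "continuous_on UNIV R''"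
    "\<And>x. R (x + 2 * pi) = R x" "\<And>x. R' (x + 2 * pi) = R' x"
    "\<And>x. \<bar>R x\<bar> \<le> MR" "\<And>x. \<bar>R' x\<bar> \<le> MR" "\<And>x. \<bar>R'' x\<bar> \<le> MR"
    by (rule C2_periodic_data[OF assms(2,4)]) blast
  define M where "M = max MP MR"
  have M: "\<bar>P x\<bar> \<le> M" "\<bar>P' x\<bar> \<le> M" "\<bar>R x\<bar> \<le> M" "\<bar>R' x\<bar> \<le> M" "\<bar>R'' x\<bar> \<le> M" for x
    using P(8,9)[of x] R(8-10)[of x] unfolding M_def by linarith+
  have dR: "deriv R = R'" using DERIV_imp_deriv[OF R(1)] by blast
  define good_radius where "good_radius \<kappa>0 r \<longleftrightarrow> 0 < r \<and> r < 1 \<and> (\<forall>\<gamma> \<kappa>. 0 < \<gamma> \<and> \<gamma> < r \<and> \<bar>\<kappa> - \<kappa>0\<bar> < r \<longrightarrow>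
      0 < \<kappa> \<and> ereal \<kappa> < kappa_star P R \<and> locks_near_diagonal P R \<gamma> \<kappa>)" for \<kappa>0 r
  have good_radius_ex: "\<exists>r. good_radius \<kappa>0 r" if "\<kappa>0 \<in> ?K" for \<kappa>0
  proof -
    have \<kappa>0: "0 < \<kappa>0" "ereal \<kappa>0 < kappa_star P R" using that by auto
    obtain \<kappa>2 where \<kappa>2: "\<kappa>0 < \<kappa>2" "ereal \<kappa>2 \<le> kappa_star P R"
      and m_le: "\<And>x. 1 - \<kappa>0 / \<kappa>2 \<le> 1 - \<kappa>0 * P x * R x"
      by (rule less_kappa_starE[OF \<kappa>0(2,1)]) blast
    have m: "0 < 1 - \<kappa>0 / \<kappa>2" using \<kappa>2 \<kappa>0 by simp
    have pos: "0 < 1 - \<kappa>0 * P x * R x" for x using m m_le[of x] by linarith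
    obtain h c H where h: "0 < c"
      "\<And>x. (h has_real_derivative (c - \<kappa>0 * P x * R' x / (1 - \<kappa>0 * P x * R x)) * h x) (at x)"
      "\<And>x. h (x + 2 * pi) = h x" "1 \<le> H" "\<And>x. h x \<le> H" "\<And>x. 1 / H \<le> h x" "C2_on UNIV h"
      by (rule reference_weight_exists[OF P(1) R(1,2) P(4) R(5) P(6) R(6,7) \<kappa>0(1) pos
            assms(5)[OF \<kappa>0, unfolded dR]]) blast
    interpret winfree_reference P P' R R' h \<kappa>0 "1 - \<kappa>0 / \<kappa>2" c M H
      by (rule winfree_reference.intro[OF P(1) R(1) M(1,3,2,4) real_mvt_bound[OF R(2) M(5)]
            P(6) R(6,7) \<kappa>0(1) m m_le h(1-6)])
    obtain r where "0 < r" and r: "\<And>\<gamma> \<kappa>. 0 \<le> \<kappa> \<Longrightarrow> \<gamma> < r \<Longrightarrow> \<bar>\<kappa> - \<kappa>0\<bar> < r \<Longrightarrow>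
        locks_near_diagonal P R \<gamma> \<kappa>"
      by (rule locks_near_reference[OF h(7) P(4) R(4)]) blast
    \<comment> \<open>Besides the radius of validity, \<open>1 / 2\<close> keeps \<gamma> below 1,
      \<open>\<kappa>0\<close> keeps \<kappa> positive, and \<open>\<kappa>2 - \<kappa>0\<close>
      keeps \<kappa> below \<kappa>*.\<close>
    define r' where "r' = min (min r (1 / 2)) (min \<kappa>0 (\<kappa>2 - \<kappa>0))"
    show ?thesis
      unfolding good_radius_def
    proof (intro exI[of _ r'] conjI allI impI)
      show "0 < r'" "r' < 1" using \<open>0 < r\<close> \<kappa>0 \<kappa>2 by (auto simp: r'_def)
      fix \<gamma> \<kappa> assume A: "0 < \<gamma> \<and> \<gamma> < r' \<and> \<bar>\<kappa> - \<kappa>0\<bar> < r'"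
      then show "0 < \<kappa>" by (auto simp: r'_def)
      have "\<kappa> < \<kappa>2" using A by (auto simp: r'_def)
      then show "ereal \<kappa> < kappa_star P R" 
        by (intro less_le_trans[OF _ \<kappa>2(2)]) simp
      show "locks_near_diagonal P R \<gamma> \<kappa>" using A \<open>0 < \<kappa>\<close> by (intro r) (auto simp: r'_def)
    qed
  qed
  define r where "r \<kappa>0 = (SOME r. good_radius \<kappa>0 r)" for \<kappa>0
  have "good_radius \<kappa>0 (r \<kappa>0)" if "\<kappa>0 \<in> ?K" for \<kappa>0
    unfolding r_def by (rule someI_ex[OF good_radius_ex[OF that]])
  then have r: "0 < r \<kappa>0" "r \<kappa>0 < 1"
    "\<And>\<gamma> \<kappa>. 0 < \<gamma> \<Longrightarrow> \<gamma> < r \<kappa>0 \<Longrightarrow> \<bar>\<kappa> - \<kappa>0\<bar> < r \<kappa>0 \<Longrightarrow>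
      0 < \<kappa> \<and> ereal \<kappa> < kappa_star P R \<and> locks_near_diagonal P R \<gamma> \<kappa>" if "\<kappa>0 \<in> ?K" for \<kappa>0
    using that unfolding good_radius_def by blast+
  \<comment> \<open>Each reference coupling contributes its own box, so every point (0, \<kappa>0)
    with \<kappa>0 strictly between 0 and \<kappa>* is in the closure even if the radii shrink
    towards the end points.\<close>
  define U where "U = (\<Union>\<kappa>0\<in>?K. {0<..<r \<kappa>0} \<times> ball \<kappa>0 (r \<kappa>0))"
  have U_D: "0 < \<gamma> \<and> \<gamma> < 1 \<and> 0 < \<kappa> \<and> ereal \<kappa> < kappa_star P R \<and> locks_near_diagonal P R \<gamma> \<kappa>"
    if U: "(\<gamma>, \<kappa>) \<in> U" for \<gamma> \<kappa>
  proof -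
    obtain \<kappa>0 where \<kappa>0: "\<kappa>0 \<in> ?K" "0 < \<gamma>" "\<gamma> < r \<kappa>0" "\<bar>\<kappa> - \<kappa>0\<bar> < r \<kappa>0"
      using U by (auto simp: U_def dist_real_def abs_minus_commute)
    show ?thesis using r(2)[OF \<kappa>0(1)] r(3)[OF \<kappa>0] \<kappa>0(2,3) by linarith
  qed
  obtain \<kappa>1 where \<kappa>1: "0 < \<kappa>1" "ereal \<kappa>1 < kappa_star P R"
    by (rule kappa_star_pos[OF M(1,3)])
  have inner: "(0, \<kappa>) \<in> closure U" if "\<kappa> \<in> ?K" for \<kappa>
    unfolding closure_approachable
  proof (intro allI impI)
    fix e :: real assume "0 < e"
    let ?\<gamma> = "min e (r \<kappa>) / 2"
    have "(?\<gamma>, \<kappa>) \<in> U" using that r[OF that] \<open>0 < e\<close> by (auto simp: U_def intro!: bexI[of _ \<kappa>])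
    moreover have "dist (?\<gamma>, \<kappa>) (0, \<kappa>) < e"
      using \<open>0 < e\<close> r[OF that] by (simp add: dist_Pair_Pair dist_real_def)
    ultimately show "\<exists>y\<in>U. dist y (0, \<kappa>) < e" by blast
  qed
  have "(0, \<kappa>) \<in> closure U" if \<kappa>: "0 \<le> \<kappa>" "ereal \<kappa> \<le> kappa_star P R" for \<kappa>
  proof (rule closed_sequentially[OF closed_closure])
    \<comment> \<open>Convex combinations of \<kappa> with the interior coupling
      \<open>\<kappa>1\<close> stay strictly inside the range and tend to \<kappa>, which covers the
      end points 0 and, when finite, \<kappa>*.\<close>
    define k where "k n = \<kappa> + (\<kappa>1 - \<kappa>) * inverse (real (Suc n))" for n
    have "k n \<in> ?K" for n
    proof -
      define s where "s = inverse (real (Suc n))"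
      have s: "0 < s" "s \<le> 1" by (auto simp: s_def inverse_eq_divide)
      have k_s: "k n = (1 - s) * \<kappa> + s * \<kappa>1" by (simp add: k_def s_def algebra_simps)
      have "0 < k n" unfolding k_s using s \<kappa>(1) \<kappa>1(1) by (intro add_nonneg_pos) auto
      moreover have "ereal (k n) < kappa_star P R"
      proof (cases "\<kappa> \<le> \<kappa>1")
        case True
        then have "(1 - s) * \<kappa> \<le> (1 - s) * \<kappa>1" using s by (intro mult_left_mono) auto
        then have "k n \<le> \<kappa>1" unfolding k_s by (simp add: algebra_simps)
        then show ?thesis by (intro le_less_trans[OF _ \<kappa>1(2)]) simp
      next
        case False
        then have "s * \<kappa>1 < s * \<kappa>" using s by simp
        then have "k n < \<kappa>" unfolding k_s by (simp add: algebra_simps)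
        then show ?thesis by (intro less_le_trans[OF _ \<kappa>(2)]) simp
      qed
      ultimately show ?thesis by simp
    qed
    then show "(0, k n) \<in> closure U" for n by (rule inner)
    have "k \<longlonglongrightarrow> \<kappa> + (\<kappa>1 - \<kappa>) * 0"
      unfolding k_def by (intro tendsto_intros LIMSEQ_inverse_real_of_nat)
    then show "(\<lambda>n. (0, k n)) \<longlonglongrightarrow> (0, \<kappa>)" by (intro tendsto_Pair) auto
  qed
  then have boundary: "{(\<gamma>, \<kappa>). \<gamma> = 0 \<and> 0 \<le> \<kappa> \<and> ereal \<kappa> \<le> kappa_star P R} \<subseteq> closure U"
    by auto
  have "open U" unfolding U_def by (intro open_UN ballI open_Times) auto
  have range: "U \<subseteq> {(\<gamma>, \<kappa>). 0 < \<gamma> \<and> \<gamma> < 1 \<and> 0 < \<kappa> \<and> ereal \<kappa> < kappa_star P R}"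
    using U_D by auto
  have locks: "\<forall>(\<gamma>, \<kappa>)\<in>U. locks_near_diagonal P R \<gamma> \<kappa>"
    using U_D by auto
  show ?thesis
    by (intro exI[of _ U] conjI \<open>open U\<close> range boundary locks[unfolded locks_near_diagonal_def])
qed

end
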